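(* Let $X$ be a Tychonoff space and let $I$ be an ideal in $C(X)$. Then the following statements are equivalent: (1) $C_{m^I}(X)$ is hemicompact. (2) $C_{m^I}(X)$ is $\sigma$-compact. (3) $C_{m^I}(X)$ is strictly $H$-bounded. (4) $C_{m^I}(X)$ is $H$-bounded. (5) $C_{m^I}(X)$ is strictly $M$-bounded. (6) $C_{m^I}(X)$ is $M$-bounded. (7) $C_{u^I}(X)$ is $M$-bounded. (8) $X$ is finite and $I=C(X)$. (9) $C_{m^I}(X)$ is locally compact and $I$ is a free ideal in $C(X)$. (10) $C_{m^I}(X)$ is locally countably compact and $I$ is a free ideal in $C(X)$. (11) $C_{m^I}(X)$ is locally pseudocompact and $I$ is a free ideal in $C(X)$.
   Context: $C(X)$ is the ring of all real-valued continuous functions on $X$; ideals may be improper. $C_+(X)$ is the set of strictly positive $u\in C(X)$. $Z(g)=\{x\in X:g(x)=0\}$; $I$ is free if $\bigcap_{g\in I}Z(g)=\emptyset$. The $u^I$-topology on $C(X)$ has as base the sets $B_u(f,I,\epsilon)=\{g\in C(X):\sup_{x\in X}|f(x)-g(x)|<\epsilon,\ f-g\in I\}$, $f\in C(X)$, $\epsilon>0$; $C_{u^I}(X)$ is $C(X)$ with this topology. The $m^I$-topology has as base the sets $B_m(f,I,u)=\{g\in C(X):|f(x)-g(x)|<u(x)\ \forall x\in X,\ f-g\in I\}$, $f\in C(X)$, $u\in C_+(X)$; $C_{m^I}(X)$ is $C(X)$ with this topology. Both are topological groups under pointwise addition. Let $G$ be a topological group, written additively. $G$ is $M$-bounded (Menger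 bounded) if for each sequence $(V_n)_{n\in\mathbb N}$ of neighborhoods of the identity there are finite sets $A_n\subseteq G$ with $G=\bigcup_{n}(A_n+V_n)$. $G$ is $H$-bounded (Hurewicz bounded) if for each such sequence there are finite sets $A_n\subseteq G$ such that each $x\in G$ belongs to all but finitely many of the sets $A_n+V_n$. Strict versions: two players A and B play a round for each $n\in\mathbb N$; in round $n$, A chooses a basic neighborhood $V_n$ of the identity and B responds with a finite set $A_n\subseteq G$. In the $M$-game B wins if $G=\bigcup_n(A_n+V_n)$; in the $H$-game B wins if each $x\in G$ belongs to all but finitely many sets $A_n+V_n$; otherwise A wins. $G$ is strictly $M$-bounded (resp. strictly $H$-bounded) if B has a winning strategy in the $M$-game (resp. $H$-game). A space is hemicompact if it has a sequence of compact subsets such that every compact subset is contained in one of them. A space is locally compact (resp. locally countably compact, locally pseudocompact) if each point has a compact (resp. countably compact, pseudocompact) neighborhood. *)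

theory Defs
  imports "HOL-Analysis.Analysis" "HOL-Algebra.Ideal"
begin

section \<open>The ring of continuous functions\<close>

text \<open>Real-valued functions on the carrier of an abstract topology are represented by
  functions that are \<^const>\<open>undefined\<close> off the carrier, so that functions with the same values
  on the space are equal.\<close>

definition cfuns :: "'a topology \<Rightarrow> ('a \<Rightarrow> real) set" where
  "cfuns X = {f \<in> extensional (topspace X). continuous_map X euclideanreal f}"

definition cfun_ring :: "'a topology \<Rightarrow> ('a \<Rightarrow> real) ring" where
  "cfun_ring X =
     \<lparr>carrier = cfuns X,
      mult = (\<lambda>f g. \<lambda>x\<in>topspace X. f x * g x),
      one = (\<lambda>x\<in>topspace X. 1),
      zero = (\<lambda>x\<in>topspace X. 0),
      add = (\<lambda>f g. \<lambda>x\<in>topspace X. f x + g x)\<rparr>"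

definition pos_cfuns :: "'a topology \<Rightarrow> ('a \<Rightarrow> real) set" where
  "pos_cfuns X = {u \<in> cfuns X. \<forall>x\<in>topspace X. 0 < u x}"

definition zero_set :: "'a topology \<Rightarrow> ('a \<Rightarrow> real) \<Rightarrow> 'a set" where
  "zero_set X g = {x \<in> topspace X. g x = 0}"

definition free_ideal :: "'a topology \<Rightarrow> ('a \<Rightarrow> real) set \<Rightarrow> bool" where
  "free_ideal X I \<longleftrightarrow> ideal I (cfun_ring X) \<and> (\<Inter>g\<in>I. zero_set X g) = {}"

lemma restrict_cfuns [simp]:
  "restrict f (topspace X) \<in> cfuns X \<longleftrightarrow> continuous_map X euclideanreal f"
  unfolding cfuns_def by (auto elim: continuous_map_eq)

lemma cring_cfun_ring: "cring (cfun_ring X)"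
proof -
  have neg: "\<exists>g\<in>cfuns X. \<forall>x. x \<in> topspace X \<longrightarrow> f x + g x = 0" if "f \<in> cfuns X" for f
    using that
    by (intro bexI[of _ "\<lambda>x\<in>topspace X. - f x"])
      (auto simp: cfuns_def intro: continuous_map_minus elim: continuous_map_eq)
  have undef: "undefined = f x" if "f \<in> cfuns X" "x \<notin> topspace X" for f x
    using that by (simp add: cfuns_def extensional_def)
  have cont: "continuous_map X euclideanreal f" if "f \<in> cfuns X" for f
    using that by (simp add: cfuns_def)
  show ?thesis
    by (intro cringI abelian_groupI comm_monoidI)
      (auto simp: cfun_ring_def neg algebra_simps fun_eq_iff cong: restrict_cong
        intro: continuous_map_add continuous_map_real_mult cont undef)
qed


section \<open>The \<open>u\<^sup>I\<close>- and \<open>m\<^sup>I\<close>-topologies\<close>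

text \<open>The supremum is taken in the extended reals, since the difference may be unbounded.\<close>

definition B_u ::
    "'a topology \<Rightarrow> ('a \<Rightarrow> real) \<Rightarrow> ('a \<Rightarrow> real) set \<Rightarrow> real \<Rightarrow> ('a \<Rightarrow> real) set" where
  "B_u X f I \<epsilon> = {g \<in> cfuns X. (SUP x\<in>topspace X. ereal \<bar>f x - g x\<bar>) < ereal \<epsilon> \<and>
                       (\<lambda>x\<in>topspace X. f x - g x) \<in> I}"

definition B_m ::
    "'a topology \<Rightarrow> ('a \<Rightarrow> real) \<Rightarrow> ('a \<Rightarrow> real) set \<Rightarrow> ('a \<Rightarrow> real) \<Rightarrow> ('a \<Rightarrow> real) set" where
  "B_m X f I u = {g \<in> cfuns X. (\<forall>x\<in>topspace X. \<bar>f x - g x\<bar> < u x) \<and>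
                       (\<lambda>x\<in>topspace X. f x - g x) \<in> I}"

definition uI_base :: "'a topology \<Rightarrow> ('a \<Rightarrow> real) set \<Rightarrow> ('a \<Rightarrow> real) set set" where
  "uI_base X I = {B_u X f I \<epsilon> | f \<epsilon>. f \<in> cfuns X \<and> 0 < \<epsilon>}"

definition mI_base :: "'a topology \<Rightarrow> ('a \<Rightarrow> real) set \<Rightarrow> ('a \<Rightarrow> real) set set" where
  "mI_base X I = {B_m X f I u | f u. f \<in> cfuns X \<and> u \<in> pos_cfuns X}"

definition uI_topology :: "'a topology \<Rightarrow> ('a \<Rightarrow> real) set \<Rightarrow> ('a \<Rightarrow> real) topology" where
  "uI_topology X I = topology (arbitrary union_of (\<lambda>B. B \<in> uI_base X I))"

definition mI_topology :: "'a topology \<Rightarrow> ('a \<Rightarrow> real) set \<Rightarrow> ('a \<Rightarrow> real) topology" where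
  "mI_topology X I = topology (arbitrary union_of (\<lambda>B. B \<in> mI_base X I))"


section \<open>Covering properties of topological groups\<close>

text \<open>A commutative topological group is given by the additive group of a ring \<open>G\<close> and a topology
  \<open>T\<close> on its carrier; only the additive structure of \<open>G\<close> is used.\<close>

definition zero_nbhd :: "('g, 'r) ring_scheme \<Rightarrow> 'g topology \<Rightarrow> 'g set \<Rightarrow> bool" where
  "zero_nbhd G T V \<longleftrightarrow> V \<subseteq> topspace T \<and> (\<exists>U. openin T U \<and> \<zero>\<^bsub>G\<^esub> \<in> U \<and> U \<subseteq> V)"

definition M_covers :: "('g, 'r) ring_scheme \<Rightarrow> (nat \<Rightarrow> 'g set) \<Rightarrow> (nat \<Rightarrow> 'g set) \<Rightarrow> bool" where
  "M_covers G A V \<longleftrightarrow> carrier G = (\<Union>n. A n <+>\<^bsub>G\<^esub> V n)"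

definition H_covers :: "('g, 'r) ring_scheme \<Rightarrow> (nat \<Rightarrow> 'g set) \<Rightarrow> (nat \<Rightarrow> 'g set) \<Rightarrow> bool" where
  "H_covers G A V \<longleftrightarrow> (\<forall>x\<in>carrier G. finite {n. x \<notin> A n <+>\<^bsub>G\<^esub> V n})"

definition M_bounded :: "('g, 'r) ring_scheme \<Rightarrow> 'g topology \<Rightarrow> bool" where
  "M_bounded G T \<longleftrightarrow>
     (\<forall>V. (\<forall>n. zero_nbhd G T (V n)) \<longrightarrow>
        (\<exists>A. (\<forall>n. finite (A n) \<and> A n \<subseteq> carrier G) \<and> M_covers G A V))"

definition H_bounded :: "('g, 'r) ring_scheme \<Rightarrow> 'g topology \<Rightarrow> bool" where
  "H_bounded G T \<longleftrightarrow>
     (\<forall>V. (\<forall>n. zero_nbhd G T (V n)) \<longrightarrow>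
        (\<exists>A. (\<forall>n. finite (A n) \<and> A n \<subseteq> carrier G) \<and> H_covers G A V))"

text \<open>In the games player A chooses members of a fixed base \<open>\<B>\<close> of the topology that contain the
  identity. A strategy for player B maps the nonempty list of all moves made so far by A to a
  finite subset of the group; B's own earlier moves are determined by the strategy and so need not
  be part of its input.\<close>

definition B_strategy :: "('g, 'r) ring_scheme \<Rightarrow> 'g set set \<Rightarrow> ('g set list \<Rightarrow> 'g set) \<Rightarrow> bool" where
  "B_strategy G \<B> \<sigma> \<longleftrightarrow>
     (\<forall>h. h \<noteq> [] \<and> (\<forall>V\<in>set h. V \<in> \<B> \<and> \<zero>\<^bsub>G\<^esub> \<in> V) \<longrightarrow> finite (\<sigma> h) \<and> \<sigma> h \<subseteq> carrier G)"

definition B_moves :: "('g set list \<Rightarrow> 'g set) \<Rightarrow> (nat \<Rightarrow> 'g set) \<Rightarrow> nat \<Rightarrow> 'g set" where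
  "B_moves \<sigma> V n = \<sigma> (map V [0..<Suc n])"

definition strictly_M_bounded :: "('g, 'r) ring_scheme \<Rightarrow> 'g set set \<Rightarrow> bool" where
  "strictly_M_bounded G \<B> \<longleftrightarrow>
     (\<exists>\<sigma>. B_strategy G \<B> \<sigma> \<and>
        (\<forall>V. (\<forall>n. V n \<in> \<B> \<and> \<zero>\<^bsub>G\<^esub> \<in> V n) \<longrightarrow> M_covers G (B_moves \<sigma> V) V))"

definition strictly_H_bounded :: "('g, 'r) ring_scheme \<Rightarrow> 'g set set \<Rightarrow> bool" where
  "strictly_H_bounded G \<B> \<longleftrightarrow>
     (\<exists>\<sigma>. B_strategy G \<B> \<sigma> \<and>
        (\<forall>V. (\<forall>n. V n \<in> \<B> \<and> \<zero>\<^bsub>G\<^esub> \<in> V n) \<longrightarrow> H_covers G (B_moves \<sigma> V) V))"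


section \<open>Compactness-type properties of spaces\<close>

definition tychonoff_space :: "'a topology \<Rightarrow> bool" where
  "tychonoff_space X \<longleftrightarrow> completely_regular_space X \<and> Hausdorff_space X"

definition hemicompact_space :: "'a topology \<Rightarrow> bool" where
  "hemicompact_space X \<longleftrightarrow>
     (\<exists>K :: nat \<Rightarrow> 'a set. (\<forall>n. compactin X (K n)) \<and> (\<forall>C. compactin X C \<longrightarrow> (\<exists>n. C \<subseteq> K n)))"

definition sigma_compact_space :: "'a topology \<Rightarrow> bool" where
  "sigma_compact_space X \<longleftrightarrow>
     (\<exists>K :: nat \<Rightarrow> 'a set. (\<forall>n. compactin X (K n)) \<and> topspace X = (\<Union>n. K n))"

definition countably_compact_space :: "'a topology \<Rightarrow> bool" where
  "countably_compact_space X \<longleftrightarrow>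
     (\<forall>\<U>. countable \<U> \<and> (\<forall>U\<in>\<U>. openin X U) \<and> topspace X \<subseteq> \<Union>\<U> \<longrightarrow>
        (\<exists>\<F>. finite \<F> \<and> \<F> \<subseteq> \<U> \<and> topspace X \<subseteq> \<Union>\<F>))"

definition pseudocompact_space :: "'a topology \<Rightarrow> bool" where
  "pseudocompact_space X \<longleftrightarrow>
     (\<forall>f. continuous_map X euclideanreal f \<longrightarrow> bounded (f ` topspace X))"

definition locally_countably_compact_space :: "'a topology \<Rightarrow> bool" where
  "locally_countably_compact_space X \<longleftrightarrow>
     (\<forall>x\<in>topspace X. \<exists>U K. openin X U \<and> x \<in> U \<and> U \<subseteq> K \<and> K \<subseteq> topspace X \<and>
        countably_compact_space (subtopology X K))"

definition locally_pseudocompact_space :: "'a topology \<Rightarrow> bool" where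
  "locally_pseudocompact_space X \<longleftrightarrow>
     (\<forall>x\<in>topspace X. \<exists>U K. openin X U \<and> x \<in> U \<and> U \<subseteq> K \<and> K \<subseteq> topspace X \<and>
        pseudocompact_space (subtopology X K))"

definition all_equivalent :: "bool list \<Rightarrow> bool" where
  "all_equivalent Ps \<longleftrightarrow> (\<forall>P\<in>set Ps. \<forall>Q\<in>set Ps. P \<longleftrightarrow> Q)"


section \<open>The two families of sets are bases of topologies on \<open>C(X)\<close>\<close>

lemma ideal_diff_closed:
  assumes I: "ideal I (cfun_ring X)" and "a \<in> I" "b \<in> I"
  shows "(\<lambda>x\<in>topspace X. a x - b x) \<in> I"
proof -
  interpret ideal I "cfun_ring X" by fact
  let ?c = "\<lambda>x\<in>topspace X. - 1 :: real"
  have c: "?c \<in> carrier (cfun_ring X)"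
    by (simp add: cfun_ring_def)
  have "?c \<otimes>\<^bsub>cfun_ring X\<^esub> b \<in> I"
    using c assms I_l_closed by blast
  then have "a \<oplus>\<^bsub>cfun_ring X\<^esub> (?c \<otimes>\<^bsub>cfun_ring X\<^esub> b) \<in> I"
    using assms by (simp add: a_closed)
  also have "a \<oplus>\<^bsub>cfun_ring X\<^esub> (?c \<otimes>\<^bsub>cfun_ring X\<^esub> b) = (\<lambda>x\<in>topspace X. a x - b x)"
    by (auto simp: cfun_ring_def)
  finally show ?thesis .
qed

lemma ideal_zero_mem: "ideal I (cfun_ring X) \<Longrightarrow> (\<lambda>x\<in>topspace X. 0) \<in> I"
  using additive_subgroup.zero_closed[OF ideal.axioms(1)] by (fastforce simp: cfun_ring_def)

lemma ideal_diff_trans: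
  assumes "ideal I (cfun_ring X)"
    and "(\<lambda>x\<in>topspace X. f x - h x) \<in> I" "(\<lambda>x\<in>topspace X. h x - g x) \<in> I"
  shows "(\<lambda>x\<in>topspace X. f x - g x) \<in> I"
proof -
  let ?T = "topspace X"
  have "(\<lambda>x\<in>?T. (\<lambda>x\<in>?T. 0) x - (\<lambda>x\<in>?T. h x - g x) x) \<in> I"
    using assms ideal_diff_closed ideal_zero_mem by blast
  then have "(\<lambda>x\<in>?T. (\<lambda>x\<in>?T. f x - h x) x -
      (\<lambda>x\<in>?T. (\<lambda>x\<in>?T. 0) x - (\<lambda>x\<in>?T. h x - g x) x) x) \<in> I"
    using assms ideal_diff_closed by blast
  then show ?thesis
    by (simp cong: restrict_cong)
qed

lemma SUP_dist_less_iff: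
  assumes "0 < \<epsilon>"
  shows "(SUP x\<in>S. ereal \<bar>f x - g x\<bar>) < ereal \<epsilon> \<longleftrightarrow>
    (\<exists>\<delta>. 0 < \<delta> \<and> \<delta> < \<epsilon> \<and> (\<forall>x\<in>S. \<bar>f x - g x\<bar> \<le> \<delta>))" (is "?L \<longleftrightarrow> ?R")
proof
  assume ?L
  then have "max 0 (SUP x\<in>S. ereal \<bar>f x - g x\<bar>) < ereal \<epsilon>"
    using assms by simp
  then obtain c where c: "max 0 (SUP x\<in>S. ereal \<bar>f x - g x\<bar>) < ereal c" "ereal c < ereal \<epsilon>"
    using ereal_dense2 by blast
  have "\<bar>f x - g x\<bar> \<le> c" if "x \<in> S" for x
  proof -
    have "ereal \<bar>f x - g x\<bar> \<le> (SUP x\<in>S. ereal \<bar>f x - g x\<bar>)"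
      using that by (rule SUP_upper)
    also have "\<dots> < ereal c" using c by simp
    finally show ?thesis by simp
  qed
  then show ?R using c by (intro exI[of _ c]) auto
next
  assume ?R
  then obtain d where d: "d < \<epsilon>" "\<forall>x\<in>S. \<bar>f x - g x\<bar> \<le> d" by blast
  then have "(SUP x\<in>S. ereal \<bar>f x - g x\<bar>) \<le> ereal d"
    by (intro SUP_least) auto
  also have "\<dots> < ereal \<epsilon>" using d by simp
  finally show ?L .
qed

lemma center_B_u: "ideal I (cfun_ring X) \<Longrightarrow> f \<in> cfuns X \<Longrightarrow> 0 < \<epsilon> \<Longrightarrow> f \<in> B_u X f I \<epsilon>"
  by (auto simp: B_u_def SUP_dist_less_iff ideal_zero_mem intro!: exI[of _ "\<epsilon> / 2"])

lemma center_B_m: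
  "ideal I (cfun_ring X) \<Longrightarrow> f \<in> cfuns X \<Longrightarrow> u \<in> pos_cfuns X \<Longrightarrow> f \<in> B_m X f I u"
  by (auto simp: B_m_def pos_cfuns_def ideal_zero_mem)

lemma B_u_refine:
  assumes "ideal I (cfun_ring X)" and "0 < \<epsilon>" and h: "h \<in> B_u X f I \<epsilon>"
  obtains \<delta> where "0 < \<delta>" "B_u X h I \<delta> \<subseteq> B_u X f I \<epsilon>"
proof -
  obtain d where d: "0 < d" "d < \<epsilon>" "\<forall>x\<in>topspace X. \<bar>f x - h x\<bar> \<le> d"
    using h assms by (auto simp: B_u_def SUP_dist_less_iff)
  have "g \<in> B_u X f I \<epsilon>" if g: "g \<in> B_u X h I (\<epsilon> - d)" for g
  proof -
    obtain e where e: "0 < e" "e < \<epsilon> - d" "\<forall>x\<in>topspace X. \<bar>h x - g x\<bar> \<le> e"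
      using g d by (auto simp: B_u_def SUP_dist_less_iff)
    have "\<bar>f x - g x\<bar> \<le> d + e" if "x \<in> topspace X" for x
      using d(3) e(3) that by (smt (verit))
    then have "\<exists>c. 0 < c \<and> c < \<epsilon> \<and> (\<forall>x\<in>topspace X. \<bar>f x - g x\<bar> \<le> c)"
      using d e by (intro exI[of _ "d + e"]) auto
    then show ?thesis
      using g h assms ideal_diff_trans[of I X f h g] by (auto simp: B_u_def SUP_dist_less_iff)
  qed
  then show thesis
    using d that[of "\<epsilon> - d"] by auto
qed

lemma B_m_refine:
  assumes "ideal I (cfun_ring X)" and "f \<in> cfuns X" "u \<in> pos_cfuns X" and h: "h \<in> B_m X f I u"
  obtains v where "v \<in> pos_cfuns X" "B_m X h I v \<subseteq> B_m X f I u"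
proof
  let ?v = "\<lambda>x\<in>topspace X. u x - \<bar>f x - h x\<bar>"
  have "continuous_map X euclideanreal (\<lambda>x. u x - \<bar>f x - h x\<bar>)"
    using assms by (intro continuous_map_diff continuous_map_real_abs)
      (auto simp: B_m_def cfuns_def pos_cfuns_def)
  then show "?v \<in> pos_cfuns X"
    using h by (auto simp: pos_cfuns_def B_m_def)
  show "B_m X h I ?v \<subseteq> B_m X f I u"
    using h assms(1) ideal_diff_trans[of I X f h] by (auto simp: B_m_def)
qed

lemma B_u_mono: "\<delta> \<le> \<epsilon> \<Longrightarrow> B_u X f I \<delta> \<subseteq> B_u X f I \<epsilon>"
  by (auto simp: B_u_def intro: less_le_trans)

lemma uI_base_Int:
  assumes I: "ideal I (cfun_ring X)" and S: "S \<in> uI_base X I" and T: "T \<in> uI_base X I"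
    and h: "h \<in> S \<inter> T"
  shows "\<exists>B\<in>uI_base X I. h \<in> B \<and> B \<subseteq> S \<inter> T"
proof -
  have hc: "h \<in> cfuns X" using h S by (auto simp: uI_base_def B_u_def)
  obtain f\<^sub>d \<epsilon>\<^sub>d where S_eq: "S = B_u X f\<^sub>d I \<epsilon>\<^sub>d" "0 < \<epsilon>\<^sub>d"
    using S unfolding uI_base_def by blast
  then obtain d where d: "0 < d" "B_u X h I d \<subseteq> S"
    using h B_u_refine[OF I, of \<epsilon>\<^sub>d h f\<^sub>d] by (metis IntD1 IntD2)
  obtain f\<^sub>e \<epsilon>\<^sub>e where T_eq: "T = B_u X f\<^sub>e I \<epsilon>\<^sub>e" "0 < \<epsilon>\<^sub>e"
    using T unfolding uI_base_def by blast
  then obtain e where e: "0 < e" "B_u X h I e \<subseteq> T"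
    using h B_u_refine[OF I, of \<epsilon>\<^sub>e h f\<^sub>e] by (metis IntD1 IntD2)
  have "B_u X h I (min d e) \<subseteq> S \<inter> T"
    using d e B_u_mono[of "min d e" d X h I] B_u_mono[of "min d e" e X h I] by auto
  moreover have "B_u X h I (min d e) \<in> uI_base X I" "h \<in> B_u X h I (min d e)"
    using d e hc center_B_u[OF I hc, of "min d e"]
    unfolding uI_base_def mem_Collect_eq by (metis min_less_iff_conj)+
  ultimately show ?thesis by blast
qed

lemma mI_base_Int:
  assumes I: "ideal I (cfun_ring X)" and S: "S \<in> mI_base X I" and T: "T \<in> mI_base X I"
    and h: "h \<in> S \<inter> T"
  shows "\<exists>B\<in>mI_base X I. h \<in> B \<and> B \<subseteq> S \<inter> T"
proof -
  have hc: "h \<in> cfuns X" using h S by (auto simp: mI_base_def B_m_def)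
  obtain v where v: "v \<in> pos_cfuns X" "B_m X h I v \<subseteq> S"
    using S h by (auto simp: mI_base_def elim!: B_m_refine[OF I])
  obtain w where w: "w \<in> pos_cfuns X" "B_m X h I w \<subseteq> T"
    using T h by (auto simp: mI_base_def elim!: B_m_refine[OF I])
  let ?m = "\<lambda>x\<in>topspace X. min (v x) (w x)"
  have m: "?m \<in> pos_cfuns X"
    using v w by (auto simp: pos_cfuns_def cfuns_def intro: continuous_map_real_min
        elim: continuous_map_eq)
  have "B_m X h I ?m \<subseteq> B_m X h I v" "B_m X h I ?m \<subseteq> B_m X h I w"
    by (auto simp: B_m_def)
  then have "B_m X h I ?m \<subseteq> S \<inter> T"
    using v w by blast
  moreover have "B_m X h I ?m \<in> mI_base X I" "h \<in> B_m X h I ?m"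
    using m hc center_B_m[OF I hc m] by (auto simp: mI_base_def)
  ultimately show ?thesis by blast
qed

lemma openin_topology_base:
  assumes "\<And>S T h. S \<in> \<B> \<Longrightarrow> T \<in> \<B> \<Longrightarrow> h \<in> S \<inter> T \<Longrightarrow> \<exists>B\<in>\<B>. h \<in> B \<and> B \<subseteq> S \<inter> T"
  shows "openin (topology (arbitrary union_of (\<lambda>B. B \<in> \<B>))) = arbitrary union_of (\<lambda>B. B \<in> \<B>)"
proof -
  have "(arbitrary union_of (\<lambda>B. B \<in> \<B>)) (S \<inter> T)" if "S \<in> \<B>" "T \<in> \<B>" for S T
    unfolding arbitrary_union_of_alt using assms[OF that] by metis
  then have "istopology (arbitrary union_of (\<lambda>B. B \<in> \<B>))"
    unfolding istopology_base_eq by blast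
  then show ?thesis
    by (rule topology_inverse')
qed

lemma openin_uI_topology:
  "ideal I (cfun_ring X) \<Longrightarrow>
    openin (uI_topology X I) = arbitrary union_of (\<lambda>B. B \<in> uI_base X I)"
  unfolding uI_topology_def by (intro openin_topology_base uI_base_Int)

lemma openin_mI_topology:
  "ideal I (cfun_ring X) \<Longrightarrow>
    openin (mI_topology X I) = arbitrary union_of (\<lambda>B. B \<in> mI_base X I)"
  unfolding mI_topology_def by (intro openin_topology_base mI_base_Int)

lemma topspace_uI_topology:
  assumes I: "ideal I (cfun_ring X)"
  shows "topspace (uI_topology X I) = cfuns X"
proof -
  have "f \<in> \<Union>(uI_base X I)" if "f \<in> cfuns X" for f
  proof
    show "B_u X f I 1 \<in> uI_base X I"
      using that zero_less_one unfolding uI_base_def by blast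
  qed (rule center_B_u[OF I that zero_less_one])
  moreover have "\<Union>(uI_base X I) \<subseteq> cfuns X"
    by (auto simp: uI_base_def B_u_def)
  moreover have "topspace (uI_topology X I) = \<Union>(uI_base X I)"
    unfolding topspace_def openin_uI_topology[OF I] by (auto simp: union_of_def arbitrary_def)
  ultimately show ?thesis by blast
qed

lemma topspace_mI_topology:
  assumes I: "ideal I (cfun_ring X)"
  shows "topspace (mI_topology X I) = cfuns X"
proof -
  have one: "(\<lambda>x\<in>topspace X. 1) \<in> pos_cfuns X"
    by (auto simp: pos_cfuns_def)
  have "f \<in> \<Union>(mI_base X I)" if "f \<in> cfuns X" for f
  proof
    show "B_m X f I (\<lambda>x\<in>topspace X. 1) \<in> mI_base X I"
      using that one unfolding mI_base_def by blast
  qed (rule center_B_m[OF I that one])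
  moreover have "\<Union>(mI_base X I) \<subseteq> cfuns X"
    by (auto simp: mI_base_def B_m_def)
  moreover have "topspace (mI_topology X I) = \<Union>(mI_base X I)"
    unfolding topspace_def openin_mI_topology[OF I] by (auto simp: union_of_def arbitrary_def)
  ultimately show ?thesis by blast
qed

end

theory Submission
  imports Defs
begin

text \<open>If \<open>X\<close> is finite and \<open>I = C(X)\<close>, the space is a finite power of the real line, and all properties
  are classical. For the way back from \<open>M\<close>-boundedness of the \<open>u\<^sup>I\<close>-topology: countably many cosets of
  \<open>I\<close> cover \<open>C(X)\<close>, so two constants are congruent modulo \<open>I\<close>, and \<open>I = C(X)\<close>. If \<open>X\<close> is infinite, play
  against the finite sets \<open>A n\<close> with neighbourhoods of radius \<open>2\<^sup>-\<^sup>n / 2\<close> and build a uniformly convergent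
  sequence whose \<open>n\<close>-th increment lies between \<open>0\<close> and \<open>2\<^sup>-\<^sup>n\<close>, moves away from every member of \<open>A n\<close>
  at a new point, and vanishes at all points used before; its limit is not covered.

  For the way back from local pseudocompactness with \<open>I\<close> free and \<open>X\<close> infinite: every neighbourhood of
  zero contains functions \<open>f n\<close> that equal \<open>v / 2\<close> at a point \<open>p n\<close> and vanish at all earlier points. They
  are uniformly separated relative to the weight \<open>v\<close>, so the reciprocal of a distance function to them,
  shifted by \<open>1 / (n + 1)\<close>, is continuous and unbounded.\<close>

section \<open>Neighbourhoods of zero\<close>

abbreviation cfun_const :: "'a topology \<Rightarrow> real \<Rightarrow> 'a \<Rightarrow> real" where
  "cfun_const X c \<equiv> (\<lambda>x\<in>topspace X. c)"

lemma carrier_cfun_ring [simp]: "carrier (cfun_ring X) = cfuns X"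
  and zero_cfun_ring [simp]: "\<zero>\<^bsub>cfun_ring X\<^esub> = cfun_const X 0"
  and one_cfun_ring [simp]: "\<one>\<^bsub>cfun_ring X\<^esub> = cfun_const X 1"
  and add_cfun_ring [simp]: "f \<oplus>\<^bsub>cfun_ring X\<^esub> g = (\<lambda>x\<in>topspace X. f x + g x)"
  and mult_cfun_ring [simp]: "f \<otimes>\<^bsub>cfun_ring X\<^esub> g = (\<lambda>x\<in>topspace X. f x * g x)"
  by (simp_all add: cfun_ring_def)

lemma cfuns_continuous_map: "f \<in> cfuns X \<Longrightarrow> continuous_map X euclideanreal f"
  by (simp add: cfuns_def)

lemma cfuns_eqI:
  "f \<in> cfuns X \<Longrightarrow> g \<in> cfuns X \<Longrightarrow> (\<And>x. x \<in> topspace X \<Longrightarrow> f x = g x) \<Longrightarrow> f = g"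
  by (auto simp: cfuns_def intro: extensionalityI)

lemma cfuns_add: "f \<in> cfuns X \<Longrightarrow> g \<in> cfuns X \<Longrightarrow> (\<lambda>x\<in>topspace X. f x + g x) \<in> cfuns X"
  by (simp add: cfuns_continuous_map continuous_map_add)

lemma cfuns_diff: "f \<in> cfuns X \<Longrightarrow> g \<in> cfuns X \<Longrightarrow> (\<lambda>x\<in>topspace X. f x - g x) \<in> cfuns X"
  by (simp add: cfuns_continuous_map continuous_map_diff)

lemma const_mem_pos_cfuns: "0 < c \<Longrightarrow> cfun_const X c \<in> pos_cfuns X"
  by (simp add: pos_cfuns_def)

lemma pos_cfuns_continuous_map: "u \<in> pos_cfuns X \<Longrightarrow> continuous_map X euclideanreal u"
  by (simp add: pos_cfuns_def cfuns_def)

lemma pos_cfuns_scale: "u \<in> pos_cfuns X \<Longrightarrow> 0 < c \<Longrightarrow> (\<lambda>x\<in>topspace X. c * u x) \<in> pos_cfuns X"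
  by (auto simp: pos_cfuns_def cfuns_continuous_map intro: continuous_map_real_mult_left)

lemma ideal_cfuns_subset: "ideal I (cfun_ring X) \<Longrightarrow> I \<subseteq> cfuns X"
  using additive_subgroup.a_subset[OF ideal.axioms(1)] by fastforce

text \<open>The multiplier may be arbitrary off the space: its restriction lies in the ring and
  gives the same product.\<close>

lemma ideal_mult_mem:
  assumes "ideal I (cfun_ring X)" "g \<in> I" "continuous_map X euclideanreal h"
  shows "(\<lambda>x\<in>topspace X. h x * g x) \<in> I"
proof -
  have "restrict h (topspace X) \<otimes>\<^bsub>cfun_ring X\<^esub> g \<in> I"
    using ideal.I_l_closed[OF assms(1,2)] assms(3) by (simp del: mult_cfun_ring)
  also have "restrict h (topspace X) \<otimes>\<^bsub>cfun_ring X\<^esub> g = (\<lambda>x\<in>topspace X. h x * g x)"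
    by auto
  finally show ?thesis .
qed

text \<open>The reciprocal of a zero-free continuous function is continuous, so \<open>g\<close> is
  a unit and an ideal containing it contains \<open>1\<close>.\<close>

lemma ideal_eq_cfuns_of_unit:
  assumes I: "ideal I (cfun_ring X)" and g: "g \<in> I" and nz: "\<And>x. x \<in> topspace X \<Longrightarrow> g x \<noteq> 0"
  shows "I = cfuns X"
proof -
  have "continuous_map X euclideanreal g"
    using g ideal_cfuns_subset[OF I] cfuns_continuous_map by blast
  then have "(\<lambda>x\<in>topspace X. inverse (g x) * g x) \<in> I"
    by (intro ideal_mult_mem[OF I g] continuous_map_real_inverse nz)
  then have "cfun_const X 1 \<in> I"
    by (simp add: nz cong: restrict_cong)
  then show ?thesis
    using ideal.one_imp_carrier[OF I] by simp
qed

section \<open>Basic open sets of the two topologies\<close>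

lemma openin_mI_base: "ideal I (cfun_ring X) \<Longrightarrow> B \<in> mI_base X I \<Longrightarrow> openin (mI_topology X I) B"
  by (simp add: openin_mI_topology arbitrary_union_of_inc)

lemma B_m_mem_mI_base: "f \<in> cfuns X \<Longrightarrow> u \<in> pos_cfuns X \<Longrightarrow> B_m X f I u \<in> mI_base X I"
  by (auto simp: mI_base_def)

lemma openin_B_m:
  "ideal I (cfun_ring X) \<Longrightarrow> f \<in> cfuns X \<Longrightarrow> u \<in> pos_cfuns X \<Longrightarrow> openin (mI_topology X I) (B_m X f I u)"
  by (intro openin_mI_base B_m_mem_mI_base)

text \<open>A base set containing \<open>f\<close> may be centred elsewhere;
  \<open>B_m_refine\<close> recentres it at \<open>f\<close>.\<close>

lemma openin_mI_topology_obtains: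
  assumes I: "ideal I (cfun_ring X)" and "openin (mI_topology X I) U" "f \<in> U"
  obtains v where "v \<in> pos_cfuns X" "B_m X f I v \<subseteq> U"
proof -
  obtain B where "B \<in> mI_base X I" "f \<in> B" "B \<subseteq> U"
    using assms(2,3) unfolding openin_mI_topology[OF I] arbitrary_union_of_alt by blast
  moreover from this obtain v where "v \<in> pos_cfuns X" "B_m X f I v \<subseteq> B"
    by (auto simp: mI_base_def elim!: B_m_refine[OF I])
  ultimately show thesis
    using that by blast
qed

lemma openin_uI_topology_obtains:
  assumes I: "ideal I (cfun_ring X)" and "openin (uI_topology X I) U" "f \<in> U"
  obtains \<epsilon> where "0 < \<epsilon>" "B_u X f I \<epsilon> \<subseteq> U"
proof -
  obtain B where B: "B \<in> uI_base X I" "f \<in> B" "B \<subseteq> U"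
    using assms(2,3) unfolding openin_uI_topology[OF I] arbitrary_union_of_alt by blast
  obtain g d where "B = B_u X g I d" "0 < d"
    using B(1) unfolding uI_base_def by blast
  then show thesis
    using B B_u_refine[OF I, of d f g] that by (metis subset_trans)
qed

lemma zero_nbhd_B_u:
  assumes I: "ideal I (cfun_ring X)" and "0 < \<epsilon>"
  shows "zero_nbhd (cfun_ring X) (uI_topology X I) (B_u X (cfun_const X 0) I \<epsilon>)"
proof -
  have 0: "cfun_const X 0 \<in> cfuns X" by simp
  have "openin (uI_topology X I) (B_u X (cfun_const X 0) I \<epsilon>)"
    unfolding openin_uI_topology[OF I] uI_base_def
    using assms(2) 0 by (intro arbitrary_union_of_inc) blast
  then show ?thesis
    unfolding zero_nbhd_def using center_B_u[OF I 0 assms(2)] openin_subset by fastforce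
qed

lemma B_u_bound: "g \<in> B_u X f I \<epsilon> \<Longrightarrow> x \<in> topspace X \<Longrightarrow> \<bar>f x - g x\<bar> < \<epsilon>"
  unfolding B_u_def
  using SUP_upper[of x "topspace X" "\<lambda>x. ereal \<bar>f x - g x\<bar>"] le_less_trans by fastforce

text \<open>A constant radius is a special case of a positive weight.\<close>

lemma zero_nbhd_uI_imp_mI:
  assumes I: "ideal I (cfun_ring X)" and V: "zero_nbhd (cfun_ring X) (uI_topology X I) V"
  shows "zero_nbhd (cfun_ring X) (mI_topology X I) V"
proof -
  let ?z = "cfun_const X 0"
  obtain d where d: "0 < d" "B_u X ?z I d \<subseteq> V"
    using V unfolding zero_nbhd_def zero_cfun_ring by (metis openin_uI_topology_obtains[OF I] subset_trans)
  \<comment> \<open>Strict pointwise bounds survive the supremum only as weak ones; halving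
    \<open>d\<close> restores strictness.\<close>
  have p: "cfun_const X (d / 2) \<in> pos_cfuns X" and z: "?z \<in> cfuns X"
    using d by (simp_all add: const_mem_pos_cfuns)
  have "B_m X ?z I (cfun_const X (d / 2)) \<subseteq> B_u X ?z I d"
  proof
    fix g assume g: "g \<in> B_m X ?z I (cfun_const X (d / 2))"
    have "\<exists>c. 0 < c \<and> c < d \<and> (\<forall>x\<in>topspace X. \<bar>?z x - g x\<bar> \<le> c)"
      using g d by (intro exI[of _ "d / 2"]) (auto simp: B_m_def)
    then show "g \<in> B_u X ?z I d"
      using g SUP_dist_less_iff[OF d(1), where S = "topspace X" and f = ?z and g = g]
      unfolding B_u_def B_m_def by blast
  qed
  then show ?thesis
    using V d openin_B_m[OF I z p] center_B_m[OF I z p]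
    unfolding zero_nbhd_def topspace_mI_topology[OF I] topspace_uI_topology[OF I] zero_cfun_ring
    by (meson subset_trans)
qed

lemma zero_nbhd_mI_obtains_base:
  assumes I: "ideal I (cfun_ring X)" and V: "zero_nbhd (cfun_ring X) (mI_topology X I) V"
  shows "\<exists>W\<in>mI_base X I. cfun_const X 0 \<in> W \<and> W \<subseteq> V"
proof -
  obtain v where v: "v \<in> pos_cfuns X" "B_m X (cfun_const X 0) I v \<subseteq> V"
    using V unfolding zero_nbhd_def zero_cfun_ring by (metis openin_mI_topology_obtains[OF I] subset_trans)
  have z: "cfun_const X 0 \<in> cfuns X"
    by simp
  show ?thesis
    using center_B_m[OF I z v(1)] v(2) by (intro bexI[OF _ B_m_mem_mI_base[OF z v(1)]] conjI)
qed

lemma mem_cfun_set_add: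
  "g \<in> A <+>\<^bsub>cfun_ring X\<^esub> V \<longleftrightarrow> (\<exists>a\<in>A. \<exists>v\<in>V. g = (\<lambda>x\<in>topspace X. a x + v x))"
  by (simp add: set_add_def')

lemma cfun_set_add_subset:
  assumes "A \<subseteq> cfuns X" "V \<subseteq> cfuns X"
  shows "A <+>\<^bsub>cfun_ring X\<^esub> V \<subseteq> cfuns X"
proof
  fix g assume "g \<in> A <+>\<^bsub>cfun_ring X\<^esub> V"
  then show "g \<in> cfuns X"
    unfolding mem_cfun_set_add using assms cfuns_add by blast
qed


section \<open>Covering properties\<close>

lemma cfun_set_add_mono:
  "W \<subseteq> V \<Longrightarrow> A <+>\<^bsub>cfun_ring X\<^esub> W \<subseteq> A <+>\<^bsub>cfun_ring X\<^esub> V"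
  unfolding subset_iff mem_cfun_set_add by blast

text \<open>A cofinite set of rounds is nonempty, so each function is caught at least once. The
  inclusions in \<open>cfuns X\<close> supply the other half of the equality in
  \<open>M_covers\<close>.\<close>

lemma H_covers_imp_M_covers:
  assumes "H_covers (cfun_ring X) A V" "\<And>n. A n \<subseteq> cfuns X" "\<And>n. V n \<subseteq> cfuns X"
  shows "M_covers (cfun_ring X) A V"
proof -
  have "g \<in> (\<Union>n. A n <+>\<^bsub>cfun_ring X\<^esub> V n)" if "g \<in> cfuns X" for g
  proof -
    have "finite {n. g \<notin> A n <+>\<^bsub>cfun_ring X\<^esub> V n}"
      using assms(1) that by (simp add: H_covers_def)
    then have "{n. g \<notin> A n <+>\<^bsub>cfun_ring X\<^esub> V n} \<noteq> UNIV"
      by (metis infinite_UNIV_nat)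
    then show ?thesis by blast
  qed
  then show ?thesis
    using cfun_set_add_subset[OF assms(2,3)] by (fastforce simp: M_covers_def)
qed

lemma H_covers_mono:
  assumes "H_covers (cfun_ring X) A W" "\<And>n. W n \<subseteq> V n"
  shows "H_covers (cfun_ring X) A V"
  unfolding H_covers_def
proof
  fix g assume "g \<in> carrier (cfun_ring X)"
  then have "finite {n. g \<notin> A n <+>\<^bsub>cfun_ring X\<^esub> W n}"
    using assms(1) by (simp add: H_covers_def)
  then show "finite {n. g \<notin> A n <+>\<^bsub>cfun_ring X\<^esub> V n}"
    by (rule rev_finite_subset) (use cfun_set_add_mono[OF assms(2)] in blast)
qed

lemma M_covers_mono:
  assumes "M_covers (cfun_ring X) A W" "\<And>n. W n \<subseteq> V n"
    and "\<And>n. A n \<subseteq> cfuns X" "\<And>n. V n \<subseteq> cfuns X"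
  shows "M_covers (cfun_ring X) A V"
proof -
  have "(\<Union>n. A n <+>\<^bsub>cfun_ring X\<^esub> W n) \<subseteq> (\<Union>n. A n <+>\<^bsub>cfun_ring X\<^esub> V n)"
    by (intro UN_mono order_refl cfun_set_add_mono assms(2))
  moreover have "(\<Union>n. A n <+>\<^bsub>cfun_ring X\<^esub> V n) \<subseteq> cfuns X"
    by (intro UN_least cfun_set_add_subset assms(3,4))
  ultimately show ?thesis
    using assms(1) by (simp add: M_covers_def)
qed

lemma mI_base_subset: "B \<in> mI_base X I \<Longrightarrow> B \<subseteq> cfuns X"
  by (auto simp: mI_base_def B_m_def)

lemma B_moves_finite:
  assumes "B_strategy G \<B> \<sigma>" "\<And>n. V n \<in> \<B> \<and> \<zero>\<^bsub>G\<^esub> \<in> V n"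
  shows "finite (B_moves \<sigma> V n) \<and> B_moves \<sigma> V n \<subseteq> carrier G"
  using assms unfolding B_strategy_def B_moves_def by simp

text \<open>Boundedness is tested on arbitrary neighbourhoods, the games on base sets only. A base
  set inside each neighbourhood is a legal move, and covering by the smaller sets passes to the
  larger ones.\<close>

lemma zero_nbhd_seq_refine:
  assumes I: "ideal I (cfun_ring X)" and V: "\<forall>n. zero_nbhd (cfun_ring X) (mI_topology X I) (V n)"
  obtains W where "\<And>n. W n \<in> mI_base X I \<and> \<zero>\<^bsub>cfun_ring X\<^esub> \<in> W n" "\<And>n. W n \<subseteq> V n"
proof -
  have "\<forall>n. \<exists>W\<in>mI_base X I. cfun_const X 0 \<in> W \<and> W \<subseteq> V n"
    using zero_nbhd_mI_obtains_base[OF I] V by blast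
  then show thesis
    using that by (metis zero_cfun_ring)
qed

lemma strictly_H_imp_H_bounded:
  assumes I: "ideal I (cfun_ring X)" and "strictly_H_bounded (cfun_ring X) (mI_base X I)"
  shows "H_bounded (cfun_ring X) (mI_topology X I)"
  unfolding H_bounded_def
proof (intro allI impI)
  fix V :: "nat \<Rightarrow> _" assume "\<forall>n. zero_nbhd (cfun_ring X) (mI_topology X I) (V n)"
  then obtain W where W: "\<And>n. W n \<in> mI_base X I \<and> \<zero>\<^bsub>cfun_ring X\<^esub> \<in> W n" "\<And>n. W n \<subseteq> V n"
    using zero_nbhd_seq_refine[OF I, of V] by metis
  obtain \<sigma> where s: "B_strategy (cfun_ring X) (mI_base X I) \<sigma>" "H_covers (cfun_ring X) (B_moves \<sigma> W) W"
    using assms(2) W(1) unfolding strictly_H_bounded_def by blast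
  show "\<exists>A. (\<forall>n. finite (A n) \<and> A n \<subseteq> carrier (cfun_ring X)) \<and> H_covers (cfun_ring X) A V"
    by (intro exI[of _ "B_moves \<sigma> W"] conjI allI B_moves_finite[OF s(1) W(1)] H_covers_mono[OF s(2) W(2)])
qed

lemma strictly_M_imp_M_bounded:
  assumes I: "ideal I (cfun_ring X)" and "strictly_M_bounded (cfun_ring X) (mI_base X I)"
  shows "M_bounded (cfun_ring X) (mI_topology X I)"
  unfolding M_bounded_def
proof (intro allI impI)
  fix V :: "nat \<Rightarrow> _" assume V: "\<forall>n. zero_nbhd (cfun_ring X) (mI_topology X I) (V n)"
  then obtain W where W: "\<And>n. W n \<in> mI_base X I \<and> \<zero>\<^bsub>cfun_ring X\<^esub> \<in> W n" "\<And>n. W n \<subseteq> V n"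
    using zero_nbhd_seq_refine[OF I, of V] by metis
  have Vc: "\<And>n. V n \<subseteq> cfuns X"
    using V by (simp add: zero_nbhd_def topspace_mI_topology[OF I])
  obtain \<sigma> where s: "B_strategy (cfun_ring X) (mI_base X I) \<sigma>" "M_covers (cfun_ring X) (B_moves \<sigma> W) W"
    using assms(2) W(1) unfolding strictly_M_bounded_def by blast
  note A = B_moves_finite[OF s(1) W(1)]
  have "M_covers (cfun_ring X) (B_moves \<sigma> W) V"
    by (intro M_covers_mono[OF s(2) W(2) _ Vc]) (use A in simp)
  then show "\<exists>A. (\<forall>n. finite (A n) \<and> A n \<subseteq> carrier (cfun_ring X)) \<and> M_covers (cfun_ring X) A V"
    by (intro exI[of _ "B_moves \<sigma> W"] conjI[OF allI[OF A]])
qed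

lemma strictly_H_imp_strictly_M_bounded:
  assumes I: "ideal I (cfun_ring X)" and "strictly_H_bounded (cfun_ring X) (mI_base X I)"
  shows "strictly_M_bounded (cfun_ring X) (mI_base X I)"
proof -
  obtain \<sigma> where s: "B_strategy (cfun_ring X) (mI_base X I) \<sigma>"
    and H: "\<And>V. \<forall>n. V n \<in> mI_base X I \<and> \<zero>\<^bsub>cfun_ring X\<^esub> \<in> V n \<Longrightarrow> H_covers (cfun_ring X) (B_moves \<sigma> V) V"
    using assms(2) unfolding strictly_H_bounded_def by blast
  have "M_covers (cfun_ring X) (B_moves \<sigma> V) V"
    if V: "\<forall>n. V n \<in> mI_base X I \<and> \<zero>\<^bsub>cfun_ring X\<^esub> \<in> V n" for V :: "nat \<Rightarrow> _"
  proof (rule H_covers_imp_M_covers[OF H[OF V]])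
    show "B_moves \<sigma> V n \<subseteq> cfuns X" for n
      using B_moves_finite[OF s, of V n] V by simp
    show "V n \<subseteq> cfuns X" for n
      using V mI_base_subset by blast
  qed
  then show ?thesis
    using s unfolding strictly_M_bounded_def by blast
qed

lemma H_imp_M_bounded:
  assumes I: "ideal I (cfun_ring X)" and H: "H_bounded (cfun_ring X) (mI_topology X I)"
  shows "M_bounded (cfun_ring X) (mI_topology X I)"
  unfolding M_bounded_def
proof (intro allI impI)
  fix V :: "nat \<Rightarrow> _" assume V: "\<forall>n. zero_nbhd (cfun_ring X) (mI_topology X I) (V n)"
  then obtain A where A: "\<forall>n. finite (A n) \<and> A n \<subseteq> carrier (cfun_ring X)" "H_covers (cfun_ring X) A V"
    using H unfolding H_bounded_def by blast
  have "M_covers (cfun_ring X) A V"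
    by (rule H_covers_imp_M_covers[OF A(2)])
      (use A V in \<open>simp_all add: zero_nbhd_def topspace_mI_topology[OF I]\<close>)
  with A show "\<exists>A. (\<forall>n. finite (A n) \<and> A n \<subseteq> carrier (cfun_ring X)) \<and> M_covers (cfun_ring X) A V"
    by blast
qed

lemma M_bounded_cfuns_cover:
  fixes V :: "nat \<Rightarrow> _"
  assumes "M_bounded (cfun_ring X) T" and "\<And>n. zero_nbhd (cfun_ring X) T (V n)"
  obtains A where "\<And>n. finite (A n)" "cfuns X = (\<Union>n. A n <+>\<^bsub>cfun_ring X\<^esub> V n)"
proof -
  have "\<exists>A. (\<forall>n. finite (A n) \<and> A n \<subseteq> carrier (cfun_ring X)) \<and> M_covers (cfun_ring X) A V"
    using assms by (simp add: M_bounded_def)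
  then show thesis
    by (elim exE conjE) (rule that, simp_all add: M_covers_def)
qed

text \<open>Neighbourhoods of zero in the coarser topology are neighbourhoods in the finer one, so
  there are fewer sequences to cover.\<close>

lemma M_bounded_mI_imp_uI:
  assumes I: "ideal I (cfun_ring X)" and "M_bounded (cfun_ring X) (mI_topology X I)"
  shows "M_bounded (cfun_ring X) (uI_topology X I)"
  using assms(2) zero_nbhd_uI_imp_mI[OF I] unfolding M_bounded_def by meson

section \<open>From compactness to a winning strategy\<close>

lemma hemicompact_imp_sigma_compact: "hemicompact_space X \<Longrightarrow> sigma_compact_space X"
proof -
  assume "hemicompact_space X"
  then obtain K :: "nat \<Rightarrow> 'a set" where K: "\<And>n. compactin X (K n)" "\<And>C. compactin X C \<Longrightarrow> \<exists>n. C \<subseteq> K n"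
    unfolding hemicompact_space_def by blast
  have "\<exists>n. x \<in> K n" if "x \<in> topspace X" for x
    using K(2)[of "{x}"] that by simp
  then have "topspace X = (\<Union>n. K n)"
    using compactin_subset_topspace[OF K(1)] by blast
  then show "sigma_compact_space X"
    using K(1) unfolding sigma_compact_space_def by blast
qed

text \<open>Balls of weight \<open>v\<close> are translates of the ball around zero, so the centres
  of a finite subcover by such balls form the finite set.\<close>

lemma compactin_mI_finite_cover:
  assumes I: "ideal I (cfun_ring X)" and C: "compactin (mI_topology X I) C"
    and V: "V \<in> mI_base X I" "cfun_const X 0 \<in> V"
  shows "\<exists>A. finite A \<and> A \<subseteq> cfuns X \<and> C \<subseteq> A <+>\<^bsub>cfun_ring X\<^esub> V"
proof -
  obtain v where v: "v \<in> pos_cfuns X" "B_m X (cfun_const X 0) I v \<subseteq> V"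
    using openin_mI_topology_obtains[OF I openin_mI_base[OF I V(1)] V(2)] .
  have Cc: "C \<subseteq> cfuns X"
    using compactin_subset_topspace[OF C] by (simp add: topspace_mI_topology[OF I])
  have 1: "\<And>U. U \<in> (\<lambda>a. B_m X a I v) ` C \<Longrightarrow> openin (mI_topology X I) U"
    using openin_B_m[OF I _ v(1)] Cc by auto
  have 2: "C \<subseteq> \<Union>((\<lambda>a. B_m X a I v) ` C)"
    using center_B_m[OF I _ v(1)] Cc by auto
  obtain \<F> where "finite \<F>" "\<F> \<subseteq> (\<lambda>a. B_m X a I v) ` C" "C \<subseteq> \<Union>\<F>"
    using compactinD[OF C 1 2] by metis
  then obtain A where A: "finite A" "A \<subseteq> C" "C \<subseteq> (\<Union>a\<in>A. B_m X a I v)"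
    by (metis finite_subset_image)
  have "g \<in> A <+>\<^bsub>cfun_ring X\<^esub> V" if g: "g \<in> C" for g
  proof -
    obtain a where a: "a \<in> A" "g \<in> B_m X a I v"
      using A g by blast
    let ?h = "\<lambda>x\<in>topspace X. g x - a x"
    have ac: "a \<in> cfuns X" and gc: "g \<in> cfuns X"
      using a A Cc g by auto
    have "?h \<in> B_m X (cfun_const X 0) I v"
      using a cfuns_diff[OF gc ac] by (simp add: B_m_def abs_minus_commute cong: restrict_cong)
    moreover have "g = (\<lambda>x\<in>topspace X. a x + ?h x)"
      by (rule cfuns_eqI[OF gc cfuns_add[OF ac cfuns_diff[OF gc ac]]]) simp
    ultimately show ?thesis
      using a v unfolding mem_cfun_set_add by blast
  qed
  with A Cc show ?thesis by blast
qed

text \<open>The strategy covers, in each round, the compact sets listed so far by translates of the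
  latest move of player A. A function in \<open>K i\<close> is then caught in every round from
  \<open>i\<close> on.\<close>

lemma sigma_compact_imp_strictly_H_bounded:
  assumes I: "ideal I (cfun_ring X)" and "sigma_compact_space (mI_topology X I)"
  shows "strictly_H_bounded (cfun_ring X) (mI_base X I)"
proof -
  obtain K :: "nat \<Rightarrow> ('a \<Rightarrow> real) set" where K: "\<And>n. compactin (mI_topology X I) (K n)" "cfuns X = (\<Union>n. K n)"
    using assms(2) unfolding sigma_compact_space_def topspace_mI_topology[OF I] by blast
  define A where "A n V = (SOME A. finite A \<and> A \<subseteq> cfuns X \<and> (\<Union>i<n. K i) \<subseteq> A <+>\<^bsub>cfun_ring X\<^esub> V)"
    for n :: nat and V
  have A: "finite (A n V) \<and> A n V \<subseteq> cfuns X \<and> (\<Union>i<n. K i) \<subseteq> A n V <+>\<^bsub>cfun_ring X\<^esub> V"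
    if "V \<in> mI_base X I \<and> cfun_const X 0 \<in> V" for n V
    unfolding A_def using that K(1)
    by (intro someI_ex[OF compactin_mI_finite_cover[OF I]] compactin_Union) auto
  \<comment> \<open>Round \<open>n\<close> is answered on a list of length \<open>n + 1\<close>, so
    the union over the indices below the length includes \<open>K n\<close> itself.\<close>
  define \<sigma> where "\<sigma> h = A (length h) (last h)" for h
  have "B_strategy (cfun_ring X) (mI_base X I) \<sigma>"
    using A by (auto simp: B_strategy_def \<sigma>_def)
  moreover have "H_covers (cfun_ring X) (B_moves \<sigma> V) V"
    if V: "\<forall>n. V n \<in> mI_base X I \<and> \<zero>\<^bsub>cfun_ring X\<^esub> \<in> V n" for V :: "nat \<Rightarrow> _"
    unfolding H_covers_def
  proof
    fix g assume "g \<in> carrier (cfun_ring X)"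
    then obtain i where i: "g \<in> K i"
      using K(2) by auto
    have "g \<in> B_moves \<sigma> V n <+>\<^bsub>cfun_ring X\<^esub> V n" if "i \<le> n" for n
    proof -
      have "B_moves \<sigma> V n = A (Suc n) (V n)"
        by (simp add: B_moves_def \<sigma>_def)
      then show ?thesis
        using A[of "V n" "Suc n"] V i that by fastforce
    qed
    then have "{n. g \<notin> B_moves \<sigma> V n <+>\<^bsub>cfun_ring X\<^esub> V n} \<subseteq> {..<i}"
      by (auto simp: not_le[symmetric])
    then show "finite {n. g \<notin> B_moves \<sigma> V n <+>\<^bsub>cfun_ring X\<^esub> V n}"
      using finite_subset by blast
  qed
  ultimately show ?thesis
    unfolding strictly_H_bounded_def by blast
qed


section \<open>Menger boundedness forces finiteness\<close>

text \<open>Urysohn's lemma for a compact and a closed set in a completely regular space; finite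
  sets are compact, hence closed as the space is Hausdorff.\<close>

lemma tychonoff_finite_interpolation:
  assumes X: "tychonoff_space X" and "finite S" "finite T" "S \<subseteq> topspace X" "T \<subseteq> topspace X" "disjnt S T"
    and "0 \<le> (c::real)"
  obtains h where "continuous_map X euclideanreal h" "\<And>x. x \<in> topspace X \<Longrightarrow> h x \<in> {0..c}"
    "\<And>x. x \<in> S \<Longrightarrow> h x = c" "\<And>x. x \<in> T \<Longrightarrow> h x = 0"
proof -
  have cr: "completely_regular_space X" and H: "Hausdorff_space X"
    using X by (auto simp: tychonoff_space_def)
  have "compactin X S" "compactin X T"
    using assms by (auto intro: finite_imp_compactin)
  then obtain h where h: "continuous_map X (subtopology euclidean {0..c}) h" "h ` T \<subseteq> {0}" "h ` S \<subseteq> {c}"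
    using Urysohn_completely_regular_compact_closed[OF assms(7) cr _ compactin_imp_closedin[OF H] assms(6)]
    by blast
  then show thesis
    by (intro that[of h]) (auto simp: continuous_map_in_subtopology Pi_iff)
qed

text \<open>Each member of \<open>A\<close> gets its own point outside \<open>F\<close>, where \<open>g\<close> or \<open>g + c\<close> is far from it.\<close>

lemma avoid_finitely_many:
  assumes X: "tychonoff_space X" "infinite (topspace X)" and g: "continuous_map X euclideanreal g"
    and F: "finite F" "F \<subseteq> topspace X" and A: "finite A" and c: "0 \<le> (c::real)"
  shows "\<exists>g' F'. continuous_map X euclideanreal g' \<and> finite F' \<and> F' \<subseteq> topspace X \<and> F \<subseteq> F' \<and>
    (\<forall>x\<in>topspace X. g x \<le> g' x \<and> g' x \<le> g x + c) \<and> (\<forall>x\<in>F. g' x = g x) \<and>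
    (\<forall>a\<in>A. \<exists>p\<in>F'. c / 2 \<le> \<bar>g' p - a p\<bar>)"
proof -
  have "infinite (topspace X - F)"
    using X(2) F(1) by simp
  then obtain P where P: "finite P" "card P = card A" "P \<subseteq> topspace X - F"
    by (metis infinite_arbitrarily_large)
  then obtain p where p: "bij_betw p A P"
    using A by (metis finite_same_card_bij)
  \<comment> \<open>\<open>S\<close> collects the points of \<open>P\<close> where \<open>g\<close>
    is within \<open>c / 2\<close> of the function assigned there. Adding \<open>c\<close> at such a
    point leaves a distance of at least \<open>c / 2\<close>; on \<open>F\<close> and on the rest of
    \<open>P\<close> nothing is added.\<close>
  define S where "S = p ` {a \<in> A. \<bar>g (p a) - a (p a)\<bar> < c / 2}"
  have SP: "S \<subseteq> P"
    using p by (auto simp: S_def bij_betw_def)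
  obtain h where h: "continuous_map X euclideanreal h" "\<And>x. x \<in> topspace X \<Longrightarrow> h x \<in> {0..c}"
    "\<And>x. x \<in> S \<Longrightarrow> h x = c" "\<And>x. x \<in> F \<union> (P - S) \<Longrightarrow> h x = 0"
  proof (rule tychonoff_finite_interpolation[OF X(1) _ _ _ _ _ c, of S "F \<union> (P - S)"])
    show "finite S" using SP P finite_subset by blast
    show "finite (F \<union> (P - S))" using F P by simp
    show "S \<subseteq> topspace X" "F \<union> (P - S) \<subseteq> topspace X" "disjnt S (F \<union> (P - S))"
      using SP P F by (auto simp: disjnt_def)
  qed blast
  have "\<exists>q\<in>F \<union> P. c / 2 \<le> \<bar>(g q + h q) - a q\<bar>" if a: "a \<in> A" for a
  proof
    show pa: "p a \<in> F \<union> P" using p a by (auto simp: bij_betw_def)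
    show "c / 2 \<le> \<bar>(g (p a) + h (p a)) - a (p a)\<bar>"
    proof (cases "\<bar>g (p a) - a (p a)\<bar> < c / 2")
      case True
      then have "h (p a) = c" using a by (intro h(3)) (auto simp: S_def)
      then show ?thesis using True by linarith
    next
      case False
      \<comment> \<open>By injectivity of \<open>p\<close>, no other member of \<open>A\<close> can
        have put \<open>p a\<close> into \<open>S\<close>.\<close>
      have "p a \<notin> S"
        using False a p by (auto simp: S_def bij_betw_def dest: inj_onD)
      then have "h (p a) = 0"
        using pa by (intro h(4)) auto
      then show ?thesis using False by simp
    qed
  qed
  then show ?thesis
    using h F P g
    by (intro exI[of _ "\<lambda>x. g x + h x"] exI[of _ "F \<union> P"]) (auto intro!: continuous_map_add)
qed

text \<open>Values at points once used are frozen, so the gaps gained at finite stages persist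
  unchanged in the uniform limit.\<close>

lemma exists_avoiding_function:
  fixes A :: "nat \<Rightarrow> ('a \<Rightarrow> real) set"
  assumes X: "tychonoff_space X" "infinite (topspace X)" and A: "\<And>n. finite (A n)"
  obtains f where "continuous_map X euclideanreal f"
    "\<And>n a. a \<in> A n \<Longrightarrow> \<exists>p\<in>topspace X. (1 / 2) ^ n / 2 \<le> \<bar>f p - a p\<bar>"
proof -
  \<comment> \<open>A stage is a pair: the current function and the finite set of points where its
    values are frozen.\<close>
  define P where "P s \<longleftrightarrow> continuous_map X euclideanreal (fst s) \<and> finite (snd s) \<and> snd s \<subseteq> topspace X"
    for s :: "('a \<Rightarrow> real) \<times> 'a set"
  define Q where "Q n s t \<longleftrightarrow> snd s \<subseteq> snd t \<and>
    (\<forall>x\<in>topspace X. fst s x \<le> fst t x \<and> fst t x \<le> fst s x + (1 / 2) ^ n) \<and>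
    (\<forall>x\<in>snd s. fst t x = fst s x) \<and> (\<forall>a\<in>A n. \<exists>p\<in>snd t. (1 / 2) ^ n / 2 \<le> \<bar>fst t p - a p\<bar>)"
    for n and s t :: "('a \<Rightarrow> real) \<times> 'a set"
  have "\<exists>s. \<forall>n. P (s n) \<and> Q n (s n) (s (Suc n))"
  proof (rule dependent_nat_choice)
    show "\<exists>s. P s"
      by (rule exI[of _ "(\<lambda>_. 0, {})"]) (simp add: P_def)
    show "\<exists>t. P t \<and> Q n s t" if "P s" for s n
      using avoid_finitely_many[OF X, of "fst s" "snd s" "A n" "(1 / 2) ^ n"] that A
      unfolding P_def Q_def by (auto 0 3)
  qed
  then obtain s where P: "\<And>n. P (s n)" and Q: "\<And>n. Q n (s n) (s (Suc n))"
    by blast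
  define g where "g n = fst (s n)" for n
  define F where "F n = snd (s n)" for n
  have gc: "continuous_map X euclideanreal (g n)" for n
    using P by (simp add: P_def g_def)
  have FX: "F n \<subseteq> topspace X" for n
    using P by (simp add: P_def F_def)
  have FF: "F n \<subseteq> F m" if "n \<le> m" for n m
    by (rule lift_Suc_mono_le[of F, OF _ that]) (use Q in \<open>simp add: Q_def F_def\<close>)
  have incr: "g n x \<le> g (Suc n) x \<and> g (Suc n) x \<le> g n x + (1 / 2) ^ n" if "x \<in> topspace X" for n x
    using Q[of n] that by (simp add: Q_def g_def)
  have keep: "g m x = g n x" if "x \<in> F n" "n \<le> m" for n m x
    using that(2)
  proof (induction m rule: dec_induct)
    case (step m)
    then have "g (Suc m) x = g m x"
      using Q[of m] FF[of n m] that(1) by (auto simp: Q_def g_def F_def)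
    then show ?case using step by simp
  qed simp
  have tail: "\<bar>g m x - g n x\<bar> \<le> 2 * (1 / 2) ^ n" if x: "x \<in> topspace X" and "n \<le> m" for n m x
  proof -
    \<comment> \<open>The geometric partial sum in closed form; the subtracted term
      \<open>2 * (1 / 2) ^ m\<close> makes the induction go through.\<close>
    have "g n x \<le> g m x \<and> g m x \<le> g n x + (2 * (1 / 2) ^ n - 2 * (1 / 2) ^ m)"
      using \<open>n \<le> m\<close>
    proof (induction m rule: dec_induct)
      case (step m)
      then show ?case using incr[OF x, of m] by auto
    qed simp
    moreover have "0 \<le> (1 / 2 :: real) ^ m" by simp
    ultimately show ?thesis by linarith
  qed
  have Cauchy: "\<exists>N. \<forall>m\<ge>N. \<forall>n\<ge>N. \<forall>x. x \<in> topspace X \<longrightarrow> dist (g m x) (g n x) < \<epsilon>"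
    if e: "0 < \<epsilon>" for \<epsilon>
  proof -
    \<comment> \<open>Each of the two functions differs from stage \<open>N\<close> by at most
      \<open>2 * (1 / 2) ^ N\<close>, which is less than half of \<open>\<epsilon>\<close>.\<close>
    obtain N where N: "(1 / 2 :: real) ^ N < \<epsilon> / 4"
      using real_arch_pow_inv[of "\<epsilon> / 4" "1 / 2"] e by auto
    have "dist (g m x) (g n x) < \<epsilon>" if "N \<le> m" "N \<le> n" "x \<in> topspace X" for m n x
      using tail[OF that(3,1)] tail[OF that(3,2)] N by (simp add: dist_real_def)
    then show ?thesis by blast
  qed
  have gce: "\<forall>\<^sub>F n in sequentially. continuous_map X euclideanreal (g n)"
    using gc by simp
  obtain f where f: "continuous_map X euclideanreal f"
    "\<And>\<epsilon>. 0 < \<epsilon> \<Longrightarrow> \<forall>\<^sub>F n in sequentially. \<forall>x\<in>topspace X. dist (g n x) (f x) < \<epsilon>"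
    by (rule Met_TC.continuous_map_uniformly_Cauchy_limit[of X g, simplified, OF complete_UNIV gce Cauchy])
      blast+
  \<comment> \<open>At a frozen point the sequence is constant from \<open>n\<close> on.\<close>
  have fF: "f p = g n p" if p: "p \<in> F n" for n p
  proof -
    have "(\<lambda>m. g m p) \<longlonglongrightarrow> f p"
      unfolding tendsto_iff
    proof (intro allI impI)
      show "\<forall>\<^sub>F m in sequentially. dist (g m p) (f p) < e" if "0 < e" for e
        by (rule eventually_mono[OF f(2)[OF that]]) (use p FX in blast)
    qed
    moreover have "(\<lambda>m. g m p) \<longlonglongrightarrow> g n p"
      by (intro tendsto_eventually eventually_sequentiallyI[of n] keep[OF p])
    ultimately show ?thesis
      using LIMSEQ_unique by blast
  qed
  show thesis
  proof (rule that[OF f(1)])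
    fix n a assume "a \<in> A n"
    then obtain p where "p \<in> F (Suc n)" "(1 / 2) ^ n / 2 \<le> \<bar>g (Suc n) p - a p\<bar>"
      using Q[of n] by (auto simp: Q_def g_def F_def)
    then show "\<exists>p\<in>topspace X. (1 / 2) ^ n / 2 \<le> \<bar>f p - a p\<bar>"
      using fF FX by (metis subsetD)
  qed
qed

lemma M_bounded_uI_imp_finite:
  assumes X: "tychonoff_space X" and I: "ideal I (cfun_ring X)"
    and M: "M_bounded (cfun_ring X) (uI_topology X I)"
  shows "finite (topspace X)"
proof (rule ccontr)
  assume inf: "infinite (topspace X)"
  \<comment> \<open>The radius equals the gap that the avoiding function keeps from every member of
    \<open>A n\<close>; being closer than the radius contradicts the gap.\<close>
  define V where "V n = B_u X (cfun_const X 0) I ((1 / 2) ^ n / 2)" for n :: nat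
  have nbhd: "zero_nbhd (cfun_ring X) (uI_topology X I) (V n)" for n
    unfolding V_def by (intro zero_nbhd_B_u[OF I]) simp
  obtain A where A: "\<And>n. finite (A n)" and cov: "cfuns X = (\<Union>n. A n <+>\<^bsub>cfun_ring X\<^esub> V n)"
    by (rule M_bounded_cfuns_cover[OF M, of V, OF nbhd]) (rule that, simp_all)
  obtain f where f: "continuous_map X euclideanreal f"
    "\<And>n a. a \<in> A n \<Longrightarrow> \<exists>p\<in>topspace X. (1 / 2) ^ n / 2 \<le> \<bar>f p - a p\<bar>"
    using exists_avoiding_function[of X A, OF X inf A] by blast
  have "restrict f (topspace X) \<in> cfuns X"
    using f(1) by simp
  then obtain n a v where n: "a \<in> A n" "v \<in> V n"
      "restrict f (topspace X) = (\<lambda>x\<in>topspace X. a x + v x)"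
    unfolding cov using mem_cfun_set_add by blast
  obtain p where p: "p \<in> topspace X" "(1 / 2) ^ n / 2 \<le> \<bar>f p - a p\<bar>"
    using f(2)[OF n(1)] by blast
  have "f p = a p + v p"
    using n(3) p(1) by (metis (no_types, lifting) restrict_apply')
  then show False
    using B_u_bound[OF n(2)[unfolded V_def] p(1)] p by simp
qed

text \<open>A translate of a basic neighbourhood of zero lies in one coset of \<open>I\<close>, so countably many cosets
  exhaust \<open>C(X)\<close>; but if \<open>I\<close> is proper then distinct constants lie in distinct cosets.\<close>

lemma M_bounded_uI_imp_eq_cfuns:
  assumes I: "ideal I (cfun_ring X)" and M: "M_bounded (cfun_ring X) (uI_topology X I)"
  shows "I = cfuns X"
proof -
  define V where "V = B_u X (cfun_const X 0) I 1"
  have nbhd: "zero_nbhd (cfun_ring X) (uI_topology X I) V"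
    unfolding V_def by (rule zero_nbhd_B_u[OF I zero_less_one])
  obtain A where A: "\<And>n::nat. finite (A n)" and cov: "cfuns X = (\<Union>n. A n <+>\<^bsub>cfun_ring X\<^esub> V)"
    by (rule M_bounded_cfuns_cover[OF M nbhd]) (rule that, simp_all)
  \<comment> \<open>Each constant \<open>r\<close> lies in a translate \<open>a + V\<close>, and
    \<open>a - r\<close> is then the negative of a member of \<open>V\<close>, which lies in
    \<open>I\<close>.\<close>
  have "\<exists>a\<in>(\<Union>n. A n). (\<lambda>x\<in>topspace X. a x - r) \<in> I" for r
  proof -
    have "cfun_const X r \<in> cfuns X" by simp
    then obtain n a v where *: "a \<in> A n" "v \<in> V" "cfun_const X r = (\<lambda>x\<in>topspace X. a x + v x)"
      unfolding cov using mem_cfun_set_add by blast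
    have "(\<lambda>x\<in>topspace X. a x - r) = (\<lambda>x\<in>topspace X. cfun_const X 0 x - v x)"
    proof
      fix x show "(\<lambda>x\<in>topspace X. a x - r) x = (\<lambda>x\<in>topspace X. cfun_const X 0 x - v x) x"
        using fun_cong[OF *(3), of x] by (auto simp: restrict_def)
    qed
    then have "(\<lambda>x\<in>topspace X. a x - r) \<in> I"
      using *(2) unfolding V_def B_u_def by simp
    then show ?thesis using * by blast
  qed
  then obtain a where a: "\<And>r. a r \<in> (\<Union>n. A n)" "\<And>r. (\<lambda>x\<in>topspace X. a r x - r) \<in> I"
    by metis
  \<comment> \<open>Uncountably many reals share countably many representatives, so two of them have
    the same one.\<close>
  have "countable (range a)"
    using a(1) A by (intro countable_subset[of "range a" "\<Union>n. A n"]) (auto intro: countable_finite)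
  then have "\<not> inj a"
    using countable_image_inj_on uncountable_UNIV_real by blast
  then obtain r s where rs: "a r = a s" "r \<noteq> s"
    unfolding inj_def by blast
  \<comment> \<open>The common representative cancels, leaving the nonzero constant
    \<open>s - r\<close>.\<close>
  have "(\<lambda>x\<in>topspace X. (\<lambda>x\<in>topspace X. a r x - r) x - (\<lambda>x\<in>topspace X. a s x - s) x) \<in> I"
    using ideal_diff_closed[OF I a(2) a(2)] .
  then have "cfun_const X (s - r) \<in> I"
    using rs(1) by (simp cong: restrict_cong)
  then show ?thesis
    by (rule ideal_eq_cfuns_of_unit[OF I]) (use rs in simp)
qed


section \<open>Finite spaces\<close>

text \<open>A finite Hausdorff space is discrete.\<close>

lemma cfuns_finite:
  assumes "tychonoff_space X" "finite (topspace X)"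
  shows "cfuns X = extensional (topspace X)"
proof -
  have "X = discrete_topology (topspace X)"
    using assms by (intro finite_t1_space_imp_discrete_topology)
      (auto simp: tychonoff_space_def Hausdorff_imp_t1_space)
  then have "continuous_map X euclideanreal f" for f
    by (metis continuous_map_from_discrete_topology topspace_euclidean UNIV_I Pi_I)
  then show ?thesis by (auto simp: cfuns_def)
qed

text \<open>Here basic sets are open boxes, so the topology is no finer than the product topology,
  and a compact box of intervals stays compact under the identity map.\<close>

lemma compactin_mI_cball:
  assumes X: "tychonoff_space X" "finite (topspace X)"
    and I: "ideal I (cfun_ring X)" "I = cfuns X"
  shows "compactin (mI_topology X I) {f \<in> cfuns X. \<forall>x\<in>topspace X. \<bar>f x\<bar> \<le> r}"
proof -
  let ?P = "product_topology (\<lambda>_. euclideanreal) (topspace X)"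
  note ext = cfuns_finite[OF X]
  have B: "B_m X f I u = PiE (topspace X) (\<lambda>x. ball (f x) (u x))" if "f \<in> cfuns X" for f u
    using that unfolding B_m_def I(2) ext by (auto simp: dist_real_def PiE_def Pi_iff)
  have op: "openin ?P U" if U: "openin (mI_topology X I) U" for U
  proof -
    obtain \<U> where \<U>: "\<U> \<subseteq> mI_base X I" "U = \<Union>\<U>"
      using U unfolding openin_mI_topology[OF I(1)] union_of_def arbitrary_def by blast
    have "openin ?P W" if "W \<in> mI_base X I" for W
      using that B X(2) by (auto simp: mI_base_def openin_PiE)
    then show ?thesis
      using \<U> by blast
  qed
  have "continuous_map ?P (mI_topology X I) id"
    unfolding continuous_map_def
  proof (intro conjI strip)
    show "id \<in> topspace ?P \<rightarrow> topspace (mI_topology X I)"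
      by (simp add: topspace_mI_topology[OF I(1)] ext PiE_def)
    fix U assume U: "openin (mI_topology X I) U"
    then have "{x \<in> topspace ?P. id x \<in> U} = U"
      using openin_subset[OF U] by (auto simp: topspace_mI_topology[OF I(1)] ext PiE_def)
    then show "openin ?P {x \<in> topspace ?P. id x \<in> U}"
      using op[OF U] by simp
  qed
  moreover have "compactin ?P (PiE (topspace X) (\<lambda>_. {-r..r}))"
    by (simp add: compactin_PiE)
  moreover have "id ` PiE (topspace X) (\<lambda>_. {-r..r}) = {f \<in> cfuns X. \<forall>x\<in>topspace X. \<bar>f x\<bar> \<le> r}"
    by (auto simp: ext PiE_def Pi_iff abs_le_iff minus_le_iff)
  ultimately show ?thesis
    by (metis image_compactin)
qed

text \<open>Closed balls of integer radius serve as the sequence; a compact set lies in one of them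
  because increasing open balls cover it.\<close>

lemma finite_imp_hemicompact:
  assumes X: "tychonoff_space X" "finite (topspace X)"
    and I: "ideal I (cfun_ring X)" "I = cfuns X"
  shows "hemicompact_space (mI_topology X I)"
proof -
  define K where "K n = {f \<in> cfuns X. \<forall>x\<in>topspace X. \<bar>f x\<bar> \<le> real n}" for n :: nat
  have "\<exists>n. C \<subseteq> K n" if C: "compactin (mI_topology X I) C" for C
  proof -
    \<comment> \<open>Adding \<open>1\<close> keeps the radius positive at \<open>n = 0\<close>; it
      reappears as the successor in \<open>K (Suc m)\<close>.\<close>
    define U where "U n = B_m X (cfun_const X 0) I (cfun_const X (real n + 1))" for n :: nat
    have Cc: "C \<subseteq> cfuns X"
      using compactin_subset_topspace[OF C] by (simp add: topspace_mI_topology[OF I(1)])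
    have "f \<in> (\<Union>n. U n)" if "f \<in> C" for f
    proof -
      obtain b where b: "\<And>x. x \<in> topspace X \<Longrightarrow> \<bar>f x\<bar> \<le> b"
        using bounded_iff[of "f ` topspace X"] X(2) finite_imp_bounded by fastforce
      obtain n where "b \<le> real n" using real_arch_simple by blast
      then have "\<bar>f x\<bar> < real n + 1" if "x \<in> topspace X" for x
        using b[OF that] by linarith
      moreover have "f \<in> I" "f \<in> cfuns X"
        using \<open>f \<in> C\<close> Cc I(2) by auto
      ultimately have "f \<in> U n"
        using ideal_diff_closed[OF I(1) ideal_zero_mem[OF I(1)] \<open>f \<in> I\<close>]
        by (simp add: U_def B_m_def)
      then show ?thesis by blast
    qed
    moreover have "openin (mI_topology X I) (U n)" for n
      unfolding U_def by (intro openin_B_m I const_mem_pos_cfuns) auto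
    ultimately obtain \<F> where "finite \<F>" "\<F> \<subseteq> range U" "C \<subseteq> \<Union>\<F>"
      using compactinD[OF C, of "range U"] by (metis rangeE subsetI)
    then obtain N where N: "finite N" "C \<subseteq> (\<Union>n\<in>N. U n)"
      by (metis finite_subset_image)
    obtain m where m: "\<forall>n\<in>N. n \<le> m"
      using N(1) finite_nat_set_iff_bounded_le by blast
    have "f \<in> K (Suc m)" if f: "f \<in> C" for f
    proof -
      obtain n where n: "n \<in> N" "f \<in> U n"
        using N f by blast
      then have "\<bar>f x\<bar> < real n + 1" if "x \<in> topspace X" for x
        using that by (auto simp: U_def B_m_def)
      then have "\<bar>f x\<bar> \<le> real (Suc m)" if "x \<in> topspace X" for x
        using that m n(1) by fastforce
      then show ?thesis using Cc f by (auto simp: K_def)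
    qed
    then show ?thesis by blast
  qed
  moreover have "compactin (mI_topology X I) (K n)" for n
    unfolding K_def by (rule compactin_mI_cball[OF X I])
  ultimately show ?thesis
    unfolding hemicompact_space_def by blast
qed

lemma finite_imp_locally_compact:
  assumes X: "tychonoff_space X" "finite (topspace X)"
    and I: "ideal I (cfun_ring X)" "I = cfuns X"
  shows "locally_compact_space (mI_topology X I)"
  unfolding locally_compact_space_def topspace_mI_topology[OF I(1)]
proof
  fix f assume f: "f \<in> cfuns X"
  obtain b where b: "\<And>x. x \<in> topspace X \<Longrightarrow> \<bar>f x\<bar> \<le> b"
    using bounded_iff[of "f ` topspace X"] X(2) finite_imp_bounded by fastforce
  have p: "cfun_const X 1 \<in> pos_cfuns X"
    by (simp add: const_mem_pos_cfuns)
  have "B_m X f I (cfun_const X 1) \<subseteq> {g \<in> cfuns X. \<forall>x\<in>topspace X. \<bar>g x\<bar> \<le> b + 1}"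
    using b by (fastforce simp: B_m_def)
  then show "\<exists>U K. openin (mI_topology X I) U \<and> compactin (mI_topology X I) K \<and> f \<in> U \<and> U \<subseteq> K"
    using openin_B_m[OF I(1) f p] center_B_m[OF I(1) f p] compactin_mI_cball[OF X I, of "b + 1"] by blast
qed

section \<open>Free ideals\<close>

lemma free_ideal_cfuns:
  assumes "ideal I (cfun_ring X)" "I = cfuns X"
  shows "free_ideal X I"
proof -
  have "cfun_const X 1 \<in> I" "zero_set X (cfun_const X 1) = {}"
    using assms(2) by (auto simp: zero_set_def)
  then show ?thesis
    using assms(1) by (fastforce simp: free_ideal_def)
qed

lemma free_ideal_obtains:
  assumes "free_ideal X I" "x \<in> topspace X"
  obtains g where "g \<in> I" "g x \<noteq> 0"
  using assms by (force simp: free_ideal_def zero_set_def)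

text \<open>Choose for each point a member of \<open>I\<close> that is nonzero there. The sum of the
  squares lies in \<open>I\<close> and has no zero.\<close>

lemma free_ideal_finite:
  assumes fin: "finite (topspace X)" and free: "free_ideal X I"
  shows "I = cfuns X"
proof -
  have I: "ideal I (cfun_ring X)"
    using free by (simp add: free_ideal_def)
  have "\<forall>x\<in>topspace X. \<exists>g. g \<in> I \<and> g x \<noteq> 0"
    using free_ideal_obtains[OF free] by blast
  then obtain g where g: "\<And>x. x \<in> topspace X \<Longrightarrow> g x \<in> I \<and> g x x \<noteq> 0"
    using bchoice[of "topspace X" "\<lambda>x g. g \<in> I \<and> g x \<noteq> 0"] by blast
  have "S \<subseteq> topspace X \<Longrightarrow> (\<lambda>y\<in>topspace X. \<Sum>x\<in>S. g x y * g x y) \<in> I" if "finite S" for S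
    using that
  proof (induction S rule: finite_induct)
    case empty
    then show ?case using ideal_zero_mem[OF I] by (simp add: restrict_def)
  next
    case (insert x S)
    have "(\<lambda>y\<in>topspace X. g x y * g x y) \<in> I"
      using insert g ideal_cfuns_subset[OF I] by (intro ideal_mult_mem[OF I] cfuns_continuous_map) auto
    with insert have "(\<lambda>y\<in>topspace X. g x y * g x y) \<oplus>\<^bsub>cfun_ring X\<^esub> (\<lambda>y\<in>topspace X. \<Sum>x\<in>S. g x y * g x y) \<in> I"
      using additive_subgroup.a_closed[OF ideal.axioms(1)[OF I]] by blast
    also have "(\<lambda>y\<in>topspace X. g x y * g x y) \<oplus>\<^bsub>cfun_ring X\<^esub> (\<lambda>y\<in>topspace X. \<Sum>x\<in>S. g x y * g x y) =
        (\<lambda>y\<in>topspace X. \<Sum>x\<in>insert x S. g x y * g x y)"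
      using insert by auto
    finally show ?case .
  qed
  from this[OF fin order_refl] show ?thesis
  proof (rule ideal_eq_cfuns_of_unit[OF I])
    fix y assume y: "y \<in> topspace X"
    have "0 < g y y * g y y"
      using g[OF y] not_real_square_gt_zero by blast
    then have "0 < (\<Sum>x\<in>topspace X. g x y * g x y)"
      by (rule sum_pos2[OF fin y]) simp
    then show "(\<lambda>y\<in>topspace X. \<Sum>x\<in>topspace X. g x y * g x y) y \<noteq> 0"
      using y by simp
  qed
qed


section \<open>Local compactness properties\<close>

lemma locally_compact_imp_locally_countably_compact:
  assumes "locally_compact_space X"
  shows "locally_countably_compact_space X"
  unfolding locally_countably_compact_space_def
proof
  fix x assume "x \<in> topspace X"
  then obtain U K where UK: "openin X U" "compactin X K" "x \<in> U" "U \<subseteq> K"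
    using assms unfolding locally_compact_space_def by blast
  have "countably_compact_space (subtopology X K)"
    unfolding countably_compact_space_def
    using compact_space_subtopology[OF UK(2)] unfolding compact_space_alt by blast
  then show "\<exists>U K. openin X U \<and> x \<in> U \<and> U \<subseteq> K \<and> K \<subseteq> topspace X \<and> countably_compact_space (subtopology X K)"
    using UK compactin_subset_topspace by blast
qed

text \<open>Preimages of the intervals from \<open>- n\<close> to \<open>n\<close> form a countable
  open cover; a finite subcover bounds the function.\<close>

lemma countably_compact_imp_pseudocompact:
  assumes "countably_compact_space X"
  shows "pseudocompact_space X"
  unfolding pseudocompact_space_def
proof (intro allI impI)
  fix f assume f: "continuous_map X euclideanreal f"
  define U where "U n = {x \<in> topspace X. f x \<in> {- real n<..<real n}}" for n :: nat
  have "openin X (U n)" for n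
    unfolding U_def by (rule openin_continuous_map_preimage[OF f]) simp
  moreover have "topspace X \<subseteq> (\<Union>n. U n)"
  proof
    fix x assume "x \<in> topspace X"
    moreover obtain n where "\<bar>f x\<bar> < real n" using reals_Archimedean2 by blast
    ultimately have "x \<in> U n" by (auto simp: U_def)
    then show "x \<in> (\<Union>n. U n)" by blast
  qed
  ultimately have "countable (range U) \<and> (\<forall>W\<in>range U. openin X W) \<and> topspace X \<subseteq> \<Union>(range U)"
    by blast
  then obtain \<F> where "finite \<F>" "\<F> \<subseteq> range U" "topspace X \<subseteq> \<Union>\<F>"
    using assms unfolding countably_compact_space_def by meson
  then obtain N where N: "finite N" "topspace X \<subseteq> (\<Union>n\<in>N. U n)"
    by (metis finite_subset_image)
  have "bounded (\<Union>n\<in>N. {- real n..real n})"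
    using N(1) by (intro bounded_UN) (auto simp: compact_imp_bounded)
  then show "bounded (f ` topspace X)"
    by (rule bounded_subset) (use N(2) in \<open>force simp: U_def\<close>)
qed

lemma locally_countably_compact_imp_locally_pseudocompact:
  "locally_countably_compact_space X \<Longrightarrow> locally_pseudocompact_space X"
  unfolding locally_countably_compact_space_def locally_pseudocompact_space_def
  using countably_compact_imp_pseudocompact by meson

section \<open>Peak functions and an unbounded reciprocal\<close>

lemma free_ideal_peak_function:
  assumes X: "tychonoff_space X" and free: "free_ideal X I" and v: "v \<in> pos_cfuns X"
    and F: "finite F" "F \<subseteq> topspace X" and p: "p \<in> topspace X" "p \<notin> F"
  obtains f where "f \<in> I" "\<And>x. x \<in> topspace X \<Longrightarrow> \<bar>f x\<bar> < v x" "f p = v p / 2" "\<And>x. x \<in> F \<Longrightarrow> f x = 0"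
proof -
  have I: "ideal I (cfun_ring X)"
    using free by (simp add: free_ideal_def)
  obtain g where g: "g \<in> I" "g p \<noteq> 0"
    using free_ideal_obtains[OF free p(1)] .
  obtain h where h: "continuous_map X euclideanreal h" "\<And>x. x \<in> topspace X \<Longrightarrow> h x \<in> {0..1}"
    "\<And>x. x \<in> {p} \<Longrightarrow> h x = 1" "\<And>x. x \<in> F \<Longrightarrow> h x = 0"
    using tychonoff_finite_interpolation[OF X, of "{p}" F 1] F p by auto
  have gc: "continuous_map X euclideanreal g"
    using g ideal_cfuns_subset[OF I] cfuns_continuous_map by blast
  \<comment> \<open>As a multiple of \<open>g\<close>, the product \<open>k * g\<close> stays in
    \<open>I\<close>. It equals \<open>h * v / 2\<close> times a factor between \<open>0\<close> and
    \<open>1\<close> that is \<open>1\<close> at \<open>p\<close>. The maximum in the denominator is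
    at least \<open>g p ^ 2\<close>, hence positive, so \<open>k\<close> is continuous.\<close>
  define k where "k x = g x * (h x * (v x / 2)) / max (g p ^ 2) (g x ^ 2)" for x
  have m: "0 < max (g p ^ 2) (g x ^ 2)" for x
    using g(2) by (simp add: less_max_iff_disj)
  have kc: "continuous_map X euclideanreal k"
    unfolding k_def using m[THEN less_imp_neq] pos_cfuns_continuous_map[OF v]
    by (intro continuous_map_real_divide continuous_map_real_mult continuous_map_real_max
        continuous_map_real_pow gc h(1)) auto
  have kg: "k x * g x = h x * (v x / 2) * (g x ^ 2 / max (g p ^ 2) (g x ^ 2))" for x
    by (simp add: k_def power2_eq_square)
  show thesis
  proof (rule that[of "\<lambda>x\<in>topspace X. k x * g x"])
    show "(\<lambda>x\<in>topspace X. k x * g x) \<in> I"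
      by (rule ideal_mult_mem[OF I g(1) kc])
    show "\<bar>(\<lambda>x\<in>topspace X. k x * g x) x\<bar> < v x" if x: "x \<in> topspace X" for x
    proof -
      have vx: "0 < v x" using v x by (simp add: pos_cfuns_def)
      have 1: "0 \<le> g x ^ 2 / max (g p ^ 2) (g x ^ 2)" "g x ^ 2 / max (g p ^ 2) (g x ^ 2) \<le> 1"
        using m[of x] by (auto simp: field_simps)
      have "0 \<le> k x * g x" unfolding kg using 1 vx h(2)[OF x] by (intro mult_nonneg_nonneg) auto
      moreover have "k x * g x \<le> 1 * (v x / 2) * 1"
        unfolding kg using 1 vx h(2)[OF x] by (intro mult_mono) auto
      ultimately show ?thesis using vx x by simp
    qed
    show "(\<lambda>x\<in>topspace X. k x * g x) p = v p / 2"
      using p g h(3) by (simp add: kg)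
    show "(\<lambda>x\<in>topspace X. k x * g x) x = 0" if "x \<in> F" for x
      using that F h(4) by (simp add: k_def subset_iff)
  qed
qed

text \<open>Small values of \<open>peak_dist p v n f\<close> say that \<open>f / v\<close> is close to \<open>1/2\<close> at \<open>p n\<close> and close to \<open>0\<close> at all
  earlier points; no \<open>f\<close> can have this for two different \<open>n\<close>.\<close>

definition peak_dist :: "(nat \<Rightarrow> 'a) \<Rightarrow> ('a \<Rightarrow> real) \<Rightarrow> nat \<Rightarrow> ('a \<Rightarrow> real) \<Rightarrow> real" where
  "peak_dist p v n f = Max ((\<lambda>j. \<bar>f (p j) / v (p j) - (if j = n then 1 / 2 else 0)\<bar>) ` {..n})"

text \<open>The shift by \<open>1 / (real n + 1)\<close> keeps the infimum positive at every
  function, yet lets it become arbitrarily small along the peak functions.\<close>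

definition peak_gap :: "(nat \<Rightarrow> 'a) \<Rightarrow> ('a \<Rightarrow> real) \<Rightarrow> ('a \<Rightarrow> real) \<Rightarrow> real" where
  "peak_gap p v f = (INF n. peak_dist p v n f + 1 / (real n + 1))"

lemma peak_dist_ge: "j \<le> n \<Longrightarrow> \<bar>f (p j) / v (p j) - (if j = n then 1 / 2 else 0)\<bar> \<le> peak_dist p v n f"
  unfolding peak_dist_def by (intro Max_ge) auto

lemma peak_dist_le:
  "(\<And>j. j \<le> n \<Longrightarrow> \<bar>f (p j) / v (p j) - (if j = n then 1 / 2 else 0)\<bar> \<le> c) \<Longrightarrow> peak_dist p v n f \<le> c"
  unfolding peak_dist_def by (intro Max.boundedI) auto

lemma peak_dist_nonneg: "0 \<le> peak_dist p v n f"
  using peak_dist_ge[of n n f p v] by linarith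

lemma peak_gap_le: "peak_gap p v f \<le> peak_dist p v n f + 1 / (real n + 1)"
  unfolding peak_gap_def
  by (intro cINF_lower bdd_belowI2[of _ 0] add_nonneg_nonneg peak_dist_nonneg) auto

lemma peak_gap_ge: "(\<And>n. c \<le> peak_dist p v n f + 1 / (real n + 1)) \<Longrightarrow> c \<le> peak_gap p v f"
  unfolding peak_gap_def by (intro cINF_greatest) auto

text \<open>Every term of the infimum is a maximum of functions with Lipschitz constant 1 in the
  coordinates of \<open>f / v\<close>. The constant does not depend on \<open>n\<close>, so it
  passes to the infimum.\<close>

lemma peak_gap_Lipschitz:
  assumes "\<And>j. 0 < v (p j)" "\<And>j. \<bar>f (p j) - g (p j)\<bar> \<le> e * v (p j)"
  shows "peak_gap p v f \<le> peak_gap p v g + e"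
proof -
  have "peak_dist p v n f \<le> peak_dist p v n g + e" for n
  proof (rule peak_dist_le)
    fix j assume j: "j \<le> n"
    have "\<bar>f (p j) / v (p j) - g (p j) / v (p j)\<bar> \<le> e"
      using assms[of j] by (simp add: divide_le_eq flip: diff_divide_distrib)
    then show "\<bar>f (p j) / v (p j) - (if j = n then 1 / 2 else 0)\<bar> \<le> peak_dist p v n g + e"
      using peak_dist_ge[OF j, of g p v] by linarith
  qed
  then have "peak_gap p v f - e \<le> peak_dist p v n g + 1 / (real n + 1)" for n
    using peak_gap_le[of p v f n] by (smt (verit))
  from peak_gap_ge[OF this] show ?thesis by simp
qed

text \<open>At most one index has \<open>peak_dist\<close> below \<open>1 / 4\<close>. Later indices
  then contribute at least \<open>1 / 4\<close>, while the shift bounds the contribution of that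
  index and of the earlier ones.\<close>

lemma peak_gap_pos: "0 < peak_gap p v f"
proof -
  \<comment> \<open>At \<open>p n\<close> the quotient \<open>f / v\<close> is within
    \<open>1 / 4\<close> of \<open>1 / 2\<close>, hence more than \<open>1 / 4\<close> away from the
    value \<open>0\<close> that the later index \<open>m\<close> demands there.\<close>
  have far: "1 / 4 \<le> peak_dist p v m f" if "n < m" "peak_dist p v n f < 1 / 4" for n m
  proof -
    have "\<bar>f (p n) / v (p n) - 1 / 2\<bar> \<le> peak_dist p v n f" "\<bar>f (p n) / v (p n)\<bar> \<le> peak_dist p v m f"
      using that(1) peak_dist_ge[of n n f p v] peak_dist_ge[of n m f p v] by simp_all
    then show ?thesis using that(2) by linarith
  qed
  show ?thesis
  proof (cases "\<exists>n. peak_dist p v n f < 1 / 4")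
    case False
    then have "1 / 4 \<le> peak_dist p v n f + 1 / (real n + 1)" for n
      by (smt (verit) divide_nonneg_nonneg of_nat_0_le_iff)
    from peak_gap_ge[OF this] show ?thesis by simp
  next
    case True
    then obtain n where n: "peak_dist p v n f < 1 / 4" by blast
    have "min (1 / 4) (1 / (real n + 1)) \<le> peak_dist p v m f + 1 / (real m + 1)" for m
    proof (cases "m \<le> n")
      case True
      then have "1 / (real n + 1) \<le> 1 / (real m + 1)"
        by (intro divide_left_mono) auto
      then show ?thesis using peak_dist_nonneg[of p v m f] by linarith
    next
      case False
      then have "1 / 4 \<le> peak_dist p v m f" using far[of n m] n by auto
      moreover have "0 \<le> 1 / (real m + 1)" by simp
      ultimately show ?thesis by linarith
    qed
    from peak_gap_ge[OF this] show ?thesis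
      by (rule less_le_trans[rotated]) simp
  qed
qed

text \<open>The Lipschitz bound is relative to \<open>v\<close>, and multiples of \<open>v\<close>
  are admissible weights, so it yields continuity.\<close>

lemma continuous_map_peak_gap:
  assumes I: "ideal I (cfun_ring X)" and v: "v \<in> pos_cfuns X" and p: "range p \<subseteq> topspace X"
  shows "continuous_map (mI_topology X I) euclideanreal (peak_gap p v)"
proof -
  have vp: "0 < v (p j)" for j
    using v p by (auto simp: pos_cfuns_def)
  have "\<exists>U. openin (mI_topology X I) U \<and> f \<in> U \<and> (\<forall>g\<in>U. peak_gap p v g \<in> ball (peak_gap p v f) \<epsilon>)"
    if f: "f \<in> cfuns X" and e: "0 < \<epsilon>" for f \<epsilon>
  proof -
    let ?w = "\<lambda>x\<in>topspace X. \<epsilon> / 2 * v x"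
    have w: "?w \<in> pos_cfuns X"
      using e v by (intro pos_cfuns_scale) auto
    have "peak_gap p v g \<in> ball (peak_gap p v f) \<epsilon>" if g: "g \<in> B_m X f I ?w" for g
    proof -
      have le: "\<bar>f (p j) - g (p j)\<bar> \<le> \<epsilon> / 2 * v (p j)" "\<bar>g (p j) - f (p j)\<bar> \<le> \<epsilon> / 2 * v (p j)" for j
        using g p by (auto simp: B_m_def image_subset_iff abs_minus_commute less_imp_le)
      have "\<bar>peak_gap p v f - peak_gap p v g\<bar> \<le> \<epsilon> / 2"
        using peak_gap_Lipschitz[of v p f g, OF vp le(1)] peak_gap_Lipschitz[of v p g f, OF vp le(2)]
        by linarith
      then show ?thesis using e by (simp add: dist_real_def)
    qed
    then show ?thesis
      using openin_B_m[OF I f w] center_B_m[OF I f w] by blast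
  qed
  then show ?thesis
    using Met_TC.continuous_map_to_metric[of "mI_topology X I" "peak_gap p v"]
    by (simp add: topspace_mI_topology[OF I])
qed

lemma locally_pseudocompact_imp_finite:
  assumes X: "tychonoff_space X" and free: "free_ideal X I"
    and loc: "locally_pseudocompact_space (mI_topology X I)"
  shows "finite (topspace X)"
proof (rule ccontr)
  assume "infinite (topspace X)"
  then obtain p :: "nat \<Rightarrow> 'a" where p: "inj p" "range p \<subseteq> topspace X"
    using infinite_iff_countable_subset by metis
  have I: "ideal I (cfun_ring X)"
    using free by (simp add: free_ideal_def)
  have z: "cfun_const X 0 \<in> topspace (mI_topology X I)"
    by (simp add: topspace_mI_topology[OF I])
  obtain U K where UK: "openin (mI_topology X I) U" "cfun_const X 0 \<in> U" "U \<subseteq> K"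
    "K \<subseteq> topspace (mI_topology X I)" "pseudocompact_space (subtopology (mI_topology X I) K)"
    using bspec[OF loc[unfolded locally_pseudocompact_space_def] z] by blast
  obtain v where v: "v \<in> pos_cfuns X" "B_m X (cfun_const X 0) I v \<subseteq> U"
    using openin_mI_topology_obtains[OF I UK(1,2)] .
  have vp: "0 < v (p j)" for j
    using v p by (auto simp: pos_cfuns_def)
  \<comment> \<open>Pseudocompactness of \<open>K\<close> bounds the reciprocal by some
    \<open>b\<close>; the peak function with index \<open>n\<close> above \<open>b\<close> will
    violate this bound.\<close>
  have "continuous_map (subtopology (mI_topology X I) K) euclideanreal (\<lambda>f. inverse (peak_gap p v f))"
    by (intro continuous_map_real_inverse continuous_map_from_subtopology continuous_map_peak_gap[OF I v(1) p(2)]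
        peak_gap_pos[THEN less_imp_neq, THEN not_sym])
  then have "bounded ((\<lambda>f. inverse (peak_gap p v f)) ` K)"
    using UK(4,5) unfolding pseudocompact_space_def by (metis topspace_subtopology_subset)
  then obtain b where b: "\<And>f. f \<in> K \<Longrightarrow> inverse (peak_gap p v f) \<le> b"
    unfolding bounded_iff by (force simp: abs_le_iff)
  obtain n :: nat where n: "b < real n"
    using reals_Archimedean2 by blast
  have pn: "p ` {..<n} \<subseteq> topspace X" "p n \<in> topspace X" "p n \<notin> p ` {..<n}"
    using p by (auto dest: injD)
  obtain f where f: "f \<in> I" "\<And>x. x \<in> topspace X \<Longrightarrow> \<bar>f x\<bar> < v x" "f (p n) = v (p n) / 2"
    "\<And>x. x \<in> p ` {..<n} \<Longrightarrow> f x = 0"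
    by (rule free_ideal_peak_function[OF X free v(1) _ pn]) (simp, rule that, assumption, simp_all)
  have "f \<in> B_m X (cfun_const X 0) I v"
    using f(1,2) ideal_cfuns_subset[OF I] ideal_diff_closed[OF I ideal_zero_mem[OF I] f(1)]
    by (auto simp: B_m_def)
  then have "inverse (peak_gap p v f) \<le> b"
    using b v UK by blast
  \<comment> \<open>The peak function takes its target values exactly, so only the shift remains in
    the gap.\<close>
  moreover have "peak_dist p v n f \<le> 0"
  proof (rule peak_dist_le)
    show "\<bar>f (p j) / v (p j) - (if j = n then 1 / 2 else 0)\<bar> \<le> 0" if "j \<le> n" for j
      using that f(3) f(4)[of "p j"] vp[of j] by (cases "j = n") auto
  qed
  then have "peak_gap p v f \<le> 1 / (real n + 1)"
    using peak_gap_le[of p v f n] by linarith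
  then have "real n + 1 \<le> inverse (peak_gap p v f)"
    using peak_gap_pos[of p v f] by (simp add: field_simps)
  ultimately show False
    using n by linarith
qed

theorem theorem6p5:
  fixes X :: "'a topology" and I :: "('a \<Rightarrow> real) set"
  assumes "tychonoff_space X"
    and "ideal I (cfun_ring X)"
  shows "all_equivalent
    [hemicompact_space (mI_topology X I),
     sigma_compact_space (mI_topology X I),
     strictly_H_bounded (cfun_ring X) (mI_base X I),
     H_bounded (cfun_ring X) (mI_topology X I),
     strictly_M_bounded (cfun_ring X) (mI_base X I),
     M_bounded (cfun_ring X) (mI_topology X I),
     M_bounded (cfun_ring X) (uI_topology X I),
     finite (topspace X) \<and> I = cfuns X,
     locally_compact_space (mI_topology X I) \<and> free_ideal X I,
     locally_countably_compact_space (mI_topology X I) \<and> free_ideal X I,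
     locally_pseudocompact_space (mI_topology X I) \<and> free_ideal X I]"
    (is "all_equivalent [?P1, ?P2, ?P3, ?P4, ?P5, ?P6, ?P7, ?P8, ?P9, ?P10, ?P11]")
proof -
  note X = assms(1) and I = assms(2)
  \<comment> \<open>Two loops through \<open>?P8\<close>: one runs over the compactness and covering
    properties, where \<open>?P3\<close> reaches \<open>?P6\<close> through both \<open>?P4\<close>
    and \<open>?P5\<close>, the other over the local properties.\<close>
  have 81: "?P8 \<Longrightarrow> ?P1"
    using finite_imp_hemicompact[OF X _ I] by blast
  have 12: "?P1 \<Longrightarrow> ?P2"
    by (rule hemicompact_imp_sigma_compact)
  have 23: "?P2 \<Longrightarrow> ?P3"
    by (rule sigma_compact_imp_strictly_H_bounded[OF I])
  have 34: "?P3 \<Longrightarrow> ?P4"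
    by (rule strictly_H_imp_H_bounded[OF I])
  have 46: "?P4 \<Longrightarrow> ?P6"
    by (rule H_imp_M_bounded[OF I])
  have 35: "?P3 \<Longrightarrow> ?P5"
    by (rule strictly_H_imp_strictly_M_bounded[OF I])
  have 56: "?P5 \<Longrightarrow> ?P6"
    by (rule strictly_M_imp_M_bounded[OF I])
  have 67: "?P6 \<Longrightarrow> ?P7"
    by (rule M_bounded_mI_imp_uI[OF I])
  have 78: "?P7 \<Longrightarrow> ?P8"
    using M_bounded_uI_imp_finite[OF X I] M_bounded_uI_imp_eq_cfuns[OF I] by blast
  have 89: "?P8 \<Longrightarrow> ?P9"
    using finite_imp_locally_compact[OF X _ I] free_ideal_cfuns[OF I] by blast
  have 910: "?P9 \<Longrightarrow> ?P10"
    using locally_compact_imp_locally_countably_compact by blast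
  have 1011: "?P10 \<Longrightarrow> ?P11"
    using locally_countably_compact_imp_locally_pseudocompact by blast
  have 118: "?P11 \<Longrightarrow> ?P8"
    using locally_pseudocompact_imp_finite[OF X] free_ideal_finite by blast
  have "?P1 \<longleftrightarrow> ?P8" "?P2 \<longleftrightarrow> ?P8" "?P3 \<longleftrightarrow> ?P8" "?P4 \<longleftrightarrow> ?P8" "?P5 \<longleftrightarrow> ?P8" "?P6 \<longleftrightarrow> ?P8" "?P7 \<longleftrightarrow> ?P8"
    "?P9 \<longleftrightarrow> ?P8" "?P10 \<longleftrightarrow> ?P8" "?P11 \<longleftrightarrow> ?P8"
    using 81 12 23 34 46 35 56 67 78 89 910 1011 118 by argo+
  then show ?thesis
    by (simp only: all_equivalent_def list.set ball_simps simp_thms)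
qed

end
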